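(* Let $\mathcal A=\{r_0,\dots,r_m\}\subset\mathbb Z^n$ with $\mathbb Z\mathcal A=\mathbb Z^n$ and fix $k\in\mathbb N$. A point $u\in\mathbb R^{m+1}$ lies in the tropicalization $\operatorname{trop}(Y^{(k)}_{\mathcal A})$ of the affine cone over the $k$-th dual variety of $X_{\mathcal A}$ if and only if \[\bigcap_{Q\in\mathbb Q[y_1,\dots,y_n],\ \deg(Q)\le k}V\!\left(\frac{\partial p_{\mathcal A,u}}{\partial Q}\right)\ne\emptyset.\] Moreover, this intersection is given by a finite number of Euler derivatives of $p_{\mathcal A,u}$.
   Context: $X_{\mathcal A}\subset\mathbb P^m$ is the closure of the image of $x\mapsto(x^{r_0}:\dots:x^{r_m})$; $X^{(k)}_{\mathcal A}\subset(\mathbb P^m)^\vee$ is the closure of the set of hyperplanes containing the $k$-th osculating space at some smooth point of $X_{\mathcal A}$; $Y^{(k)}_{\mathcal A}\subset\mathbb C^{m+1}$ its affine cone. For $Y\subset\mathbb C^{m+1}$ with ideal $I$ defined over $\mathbb Q$, $\operatorname{trop}(Y)=\{w:\operatorname{in}_w(F)\text{ is not a monomial for all }0\ne F\in I\}$, with $\operatorname{in}_w(F)$ the sum of terms $F_\alpha x^\alpha$ minimizing $\langle\alpha,w\rangle$. For $u\in\mathbb R^{m+1}$, the tropical polynomial $p_{\mathcal A,u}\colon\mathbb R^n\to\mathbb R$ is $p_{\mathcal A,u}(w)=\min_{i=0,\dots,m}(u_i+\langle w,r_i\rangle)$. For a polynomial $Q$, the Euler derivative $\frac{\partial p_{\mathcal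 A,u}}{\partial Q}$ is the tropical polynomial $\min\{u_i+\langle w,r_i\rangle: Q(r_i)\ne0\}$ (the subsum of terms of $p_{\mathcal A,u}$ for points $r_i$ where $Q$ does not vanish). For a tropical polynomial $p$, $V(p)\subset\mathbb R^n$ is the set of $w$ where the minimum is attained by at least two terms (with the convention that the tropical polynomial with no terms vanishes on all of $\mathbb R^n$).
   Formalization: The k-th dual variety is taken as the closure of hyperplanes containing the k-th osculating space at a point of the dense torus of X_A, rather than at any smooth point; with all smooth points the equivalence can fail, since osculating spaces may drop dimension at boundary points. *)

theory Defs
  imports Complex_Main
begin

text \<open>Multivariate polynomials in the variables indexed by a finite type 'v are
  represented as finitely supported coefficient functions on exponent vectors.\<close>

definition mpoly_fin :: "(('v \<Rightarrow> nat) \<Rightarrow> 'a::zero) \<Rightarrow> bool" where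
  "mpoly_fin F \<longleftrightarrow> finite {\<alpha>. F \<alpha> \<noteq> 0}"

definition mpoly_eval :: "(('v::finite \<Rightarrow> nat) \<Rightarrow> 'a::comm_semiring_1) \<Rightarrow> ('v \<Rightarrow> 'a) \<Rightarrow> 'a" where
  "mpoly_eval F c = (\<Sum>\<alpha> | F \<alpha> \<noteq> 0. F \<alpha> * (\<Prod>v\<in>UNIV. c v ^ \<alpha> v))"

definition deg_le :: "(('v::finite \<Rightarrow> nat) \<Rightarrow> 'a::zero) \<Rightarrow> nat \<Rightarrow> bool" where
  "deg_le F k \<longleftrightarrow> (\<forall>\<alpha>. F \<alpha> \<noteq> 0 \<longrightarrow> (\<Sum>v\<in>UNIV. \<alpha> v) \<le> k)"

definition zariski_closure :: "('v::finite \<Rightarrow> complex) set \<Rightarrow> ('v \<Rightarrow> complex) set" where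
  "zariski_closure S = {c. \<forall>F :: ('v \<Rightarrow> nat) \<Rightarrow> complex. mpoly_fin F \<longrightarrow>
        (\<forall>s\<in>S. mpoly_eval F s = 0) \<longrightarrow> mpoly_eval F c = 0}"

definition vanishing_ideal :: "('v::finite \<Rightarrow> complex) set \<Rightarrow> (('v \<Rightarrow> nat) \<Rightarrow> complex) set" where
  "vanishing_ideal Y = {F. mpoly_fin F \<and> (\<forall>c\<in>Y. mpoly_eval F c = 0)}"

definition initial_is_monomial :: "('v::finite \<Rightarrow> real) \<Rightarrow> (('v \<Rightarrow> nat) \<Rightarrow> complex) \<Rightarrow> bool" where
  "initial_is_monomial w F \<longleftrightarrow> (\<exists>\<alpha>. F \<alpha> \<noteq> 0 \<and>
      (\<forall>\<beta>. F \<beta> \<noteq> 0 \<and> \<beta> \<noteq> \<alpha> \<longrightarrow> (\<Sum>v\<in>UNIV. real (\<alpha> v) * w v) < (\<Sum>v\<in>UNIV. real (\<beta> v) * w v)))"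

definition trop :: "('v::finite \<Rightarrow> complex) set \<Rightarrow> ('v \<Rightarrow> real) set" where
  "trop Y = {w. \<forall>F\<in>vanishing_ideal Y. F \<noteq> (\<lambda>_. 0) \<longrightarrow> \<not> initial_is_monomial w F}"

definition mono_int :: "('n::finite \<Rightarrow> complex) \<Rightarrow> ('n \<Rightarrow> int) \<Rightarrow> complex" where
  "mono_int x e = (\<Prod>j\<in>UNIV. x j powi e j)"

definition falling_int :: "int \<Rightarrow> nat \<Rightarrow> complex" where
  "falling_int a b = (\<Prod>t<b. of_int a - of_nat t)"

text \<open>The partial derivative d^alpha of the parametrisation x |-> (x^{r_i})_i at x.\<close>
definition osc_vec :: "('i \<Rightarrow> 'n::finite \<Rightarrow> int) \<Rightarrow> ('n \<Rightarrow> complex) \<Rightarrow> ('n \<Rightarrow> nat) \<Rightarrow> 'i \<Rightarrow> complex" where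
  "osc_vec r x \<alpha> i = (\<Prod>j\<in>UNIV. falling_int (r i j) (\<alpha> j)) * mono_int x (\<lambda>j. r i j - int (\<alpha> j))"

text \<open>Nonzero (affine representatives of) hyperplanes containing the k-th osculating
  space of X_A at a torus point: they kill all partial derivatives of order <= k.\<close>
definition osc_hyperplanes :: "('i::finite \<Rightarrow> 'n::finite \<Rightarrow> int) \<Rightarrow> nat \<Rightarrow> ('i \<Rightarrow> complex) set" where
  "osc_hyperplanes r k = {c. c \<noteq> (\<lambda>_. 0) \<and> (\<exists>x. (\<forall>j. x j \<noteq> 0) \<and>
      (\<forall>\<alpha>. (\<Sum>j\<in>UNIV. \<alpha> j) \<le> k \<longrightarrow> (\<Sum>i\<in>UNIV. c i * osc_vec r x \<alpha> i) = 0))}"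

definition dual_cone :: "('i::finite \<Rightarrow> 'n::finite \<Rightarrow> int) \<Rightarrow> nat \<Rightarrow> ('i \<Rightarrow> complex) set" where
  "dual_cone r k = zariski_closure (osc_hyperplanes r k)"

definition trop_term :: "('i \<Rightarrow> 'n::finite \<Rightarrow> int) \<Rightarrow> ('i \<Rightarrow> real) \<Rightarrow> 'i \<Rightarrow> ('n \<Rightarrow> real) \<Rightarrow> real" where
  "trop_term r u i w = u i + (\<Sum>j\<in>UNIV. w j * of_int (r i j))"

definition trop_V :: "'i set \<Rightarrow> ('i \<Rightarrow> ('n \<Rightarrow> real) \<Rightarrow> real) \<Rightarrow> ('n \<Rightarrow> real) set" where
  "trop_V S f = {w. S = {} \<or> (\<exists>i\<in>S. \<exists>j\<in>S. i \<noteq> j \<and> f i w = f j w \<and> (\<forall>l\<in>S. f i w \<le> f l w))}"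

definition euler_V :: "('i \<Rightarrow> 'n::finite \<Rightarrow> int) \<Rightarrow> ('i \<Rightarrow> real) \<Rightarrow> (('n \<Rightarrow> nat) \<Rightarrow> rat) \<Rightarrow> ('n \<Rightarrow> real) set" where
  "euler_V r u Q = trop_V {i. mpoly_eval Q (\<lambda>j. of_int (r i j)) \<noteq> 0} (trop_term r u)"

end

theory Submission
  imports Defs "HOL-Library.Function_Algebras" "HOL-Computational_Algebra.Polynomial"
begin

text \<open>Over the torus, a hyperplane \<open>c\<close> contains the \<open>k\<close>-th osculating space at \<open>x\<close> iff
  \<open>d = (c\<^sub>i x^r\<^sub>i)\<^sub>i\<close> lies in the rational linear space \<open>K\<close> orthogonal to the value vectors of all
  polynomials of degree at most \<open>k\<close>. A point \<open>w\<close> of the intersection says that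
  \<open>v\<^sub>i = u\<^sub>i + \<langle>w, r\<^sub>i\<rangle>\<close> is in the tropicalization of \<open>K\<close>. Then there is a curve \<open>d(t)\<close> in \<open>K\<close>,
  \<open>t > 0\<close> real, with \<open>d\<^sub>i(t)\<close> asymptotic to a nonzero multiple of \<open>t^v\<^sub>i\<close>; dividing by the torus
  curve \<open>x(t) = t^w\<close> gives a curve of hyperplanes of order \<open>u\<close>, along which a polynomial with
  monomial initial form cannot vanish.

  Conversely, if \<open>u\<close> is in the tropicalization of the dual cone, then in the ring of functions of
  \<open>(d, x, t)\<close> the combinations of \<open>c\<^sup>\<alpha> t\<^sup>\<gamma>\<close> of weight \<open>\<gamma> + \<langle>\<alpha>, u\<rangle> > 0\<close> form a proper ideal
  of those of weight \<open>\<ge> 0\<close>. Chevalley's argument extends this pair to one that behaves like a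
  valuation ring on units. The values of the \<open>x\<^sub>j\<close> lie in some ordered abelian group, but only
  finitely many rational linear inequalities between them matter, and Fourier-Motzkin elimination
  solves these by a real vector \<open>w\<close>. The linear relations among the \<open>d\<^sub>i\<close> then force the minima
  to be attained twice.\<close>

section \<open>Chevalley's extension theorem on units\<close>

text \<open>A subring with a proper ideal of it. Chevalley's argument enlarges both together,
  ordered by inclusion in each component.\<close>

definition ring_ideal_pair :: "'a::comm_ring_1 set \<Rightarrow> 'a set \<Rightarrow> bool" where
  "ring_ideal_pair B m \<longleftrightarrow> 1 \<in> B \<and> (\<forall>x\<in>B. \<forall>y\<in>B. x - y \<in> B \<and> x * y \<in> B) \<and>
     m \<subseteq> B \<and> 0 \<in> m \<and> (\<forall>x\<in>m. \<forall>y\<in>m. x + y \<in> m) \<and> (\<forall>x\<in>B. \<forall>y\<in>m. x * y \<in> m) \<and> 1 \<notin> m"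

lemma ring_ideal_pairI:
  assumes "1 \<in> B" "\<And>x y. x \<in> B \<Longrightarrow> y \<in> B \<Longrightarrow> x - y \<in> B \<and> x * y \<in> B" "m \<subseteq> B" "0 \<in> m"
    "\<And>x y. x \<in> m \<Longrightarrow> y \<in> m \<Longrightarrow> x + y \<in> m" "\<And>x y. x \<in> B \<Longrightarrow> y \<in> m \<Longrightarrow> x * y \<in> m" "1 \<notin> m"
  shows "ring_ideal_pair B m"
  unfolding ring_ideal_pair_def
  by (intro conjI ballI) (simp_all add: assms)

lemma ring_ideal_pairD:
  assumes "ring_ideal_pair B m"
  shows "1 \<in> B" "0 \<in> B" "x \<in> B \<Longrightarrow> y \<in> B \<Longrightarrow> x - y \<in> B" "x \<in> B \<Longrightarrow> - x \<in> B"
    "x \<in> B \<Longrightarrow> y \<in> B \<Longrightarrow> x + y \<in> B" "x \<in> B \<Longrightarrow> y \<in> B \<Longrightarrow> x * y \<in> B"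
    "x \<in> m \<Longrightarrow> x \<in> B" "0 \<in> m" "x \<in> m \<Longrightarrow> y \<in> m \<Longrightarrow> x + y \<in> m"
    "x \<in> B \<Longrightarrow> y \<in> m \<Longrightarrow> x * y \<in> m" "x \<in> m \<Longrightarrow> y \<in> B \<Longrightarrow> x * y \<in> m"
    "x \<in> m \<Longrightarrow> - x \<in> m" "x \<in> m \<Longrightarrow> y \<in> m \<Longrightarrow> x - y \<in> m" "1 \<notin> m"
proof -
  have B: "1 \<in> B" "\<And>x y. x \<in> B \<Longrightarrow> y \<in> B \<Longrightarrow> x - y \<in> B" "\<And>x y. x \<in> B \<Longrightarrow> y \<in> B \<Longrightarrow> x * y \<in> B"
    and m: "\<And>x. x \<in> m \<Longrightarrow> x \<in> B" "0 \<in> m" "\<And>x y. x \<in> m \<Longrightarrow> y \<in> m \<Longrightarrow> x + y \<in> m"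
      "\<And>x y. x \<in> B \<Longrightarrow> y \<in> m \<Longrightarrow> x * y \<in> m" "1 \<notin> m"
    using assms unfolding ring_ideal_pair_def by (simp_all add: subset_iff)
  have z: "0 \<in> B" using m(1,2) .
  have n: "- x \<in> B" if "x \<in> B" for x using B(2)[OF z that] by simp
  have nm: "- x \<in> m" if "x \<in> m" for x using m(4)[OF n[OF B(1)] that] by simp
  show "1 \<in> B" "0 \<in> B" "x \<in> B \<Longrightarrow> y \<in> B \<Longrightarrow> x - y \<in> B" "x \<in> B \<Longrightarrow> - x \<in> B"
    "x \<in> B \<Longrightarrow> y \<in> B \<Longrightarrow> x * y \<in> B"
    "x \<in> m \<Longrightarrow> x \<in> B" "0 \<in> m" "x \<in> m \<Longrightarrow> y \<in> m \<Longrightarrow> x + y \<in> m"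
    "x \<in> B \<Longrightarrow> y \<in> m \<Longrightarrow> x * y \<in> m" "x \<in> m \<Longrightarrow> - x \<in> m" "1 \<notin> m"
    by (fact B m z n nm)+
  show "x \<in> B \<Longrightarrow> y \<in> B \<Longrightarrow> x + y \<in> B" using B(2)[OF _ n, of x y] by simp
  show "x \<in> m \<Longrightarrow> y \<in> B \<Longrightarrow> x * y \<in> m" using m(4)[of y x] by (simp add: mult.commute)
  show "x \<in> m \<Longrightarrow> y \<in> m \<Longrightarrow> x - y \<in> m" using m(3)[OF _ nm, of x y] by simp
qed

lemma ring_ideal_pair_sum:
  assumes "ring_ideal_pair B m"
  shows "(\<And>i. i \<in> A \<Longrightarrow> f i \<in> B) \<Longrightarrow> sum f A \<in> B" "(\<And>i. i \<in> A \<Longrightarrow> f i \<in> m) \<Longrightarrow> sum f A \<in> m"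
  by (induction A rule: infinite_finite_induct; simp add: ring_ideal_pairD(2,5,8,9)[OF assms])+

lemma ring_ideal_pair_power:
  assumes "ring_ideal_pair B m" "x \<in> B"
  shows "x ^ n \<in> B"
  using ring_ideal_pairD(1,6)[OF assms(1)] assms(2) by (induction n) auto

text \<open>Chevalley's degree descent: the constant term of \<open>q\<close> and the reflected polynomial
  of \<open>q\<close> are used to remove the leading term of \<open>p\<close>.\<close>
lemma poly_ideal_unit_inverse:
  fixes p q :: "'a::comm_ring_1 poly"
  assumes pair: "ring_ideal_pair B m" and xy: "x * y = 1"
    and "\<And>i. coeff p i \<in> m" "\<And>i. coeff q i \<in> m" "poly p x = 1" "poly q y = 1"
  shows False
  using assms(2-)
proof (induction "degree p + degree q" arbitrary: p q x y rule: less_induct)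
  case less
  note R = ring_ideal_pairD[OF pair]
  \<comment> \<open>The situation is symmetric in \<open>(p, x)\<close> and \<open>(q, y)\<close>.
    The fact \<open>red\<close> lowers the degree of the polynomial of larger degree; the induction
    hypothesis enters as its premise \<open>IH\<close>.\<close>
  have red: False if xy: "x * y = 1" and p: "\<And>i. coeff p i \<in> m" and q: "\<And>i. coeff q i \<in> m"
    and px: "poly p x = 1" and qy: "poly q y = 1" and le: "degree q \<le> degree p"
    and IH: "\<And>p'. degree p' < degree p \<Longrightarrow> (\<And>i. coeff p' i \<in> m) \<Longrightarrow> poly p' x = 1 \<Longrightarrow> False"
    for p q :: "'a poly" and x y
  proof (cases "degree p = 0")
    case True
    then obtain a where "p = [:a:]" using degree_eq_zeroE by blast
    with p[of 0] px R(14) show False by simp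
  next
    case False
    let ?n = "degree p" and ?l = "degree q" and ?c = "coeff q 0"
    \<comment> \<open>\<open>s\<close> has coefficients in \<open>B\<close>, vanishes at
      \<open>x\<close> because the reflected polynomial takes the value
      \<open>x ^ ?l * poly q y\<close> there, and has coefficient \<open>?c - 1\<close> in degree
      \<open>?l\<close>.\<close>
    define s where "s = reflect_poly q - monom 1 ?l"
    have yx: "x ^ j * y ^ j = 1" for j using xy by (simp flip: power_mult_distrib)
    have "poly (reflect_poly q) x = (\<Sum>i\<le>?l. coeff (reflect_poly q) i * x ^ i)"
      using arg_cong[OF poly_as_sum_of_monoms'[OF degree_reflect_poly_le[of q]], of "\<lambda>p. poly p x"]
      by (simp add: poly_sum poly_monom)
    also have "\<dots> = (\<Sum>i\<le>?l. coeff q (?l - i) * x ^ i)"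
      by (simp add: coeff_reflect_poly)
    also have "\<dots> = (\<Sum>i\<le>?l. coeff q i * x ^ (?l - i))"
      by (rule sum.reindex_bij_witness[of _ "\<lambda>i. ?l - i" "\<lambda>i. ?l - i"]) auto
    also have "\<dots> = (\<Sum>i\<le>?l. coeff q i * (x ^ ?l * y ^ i))"
    proof (intro sum.cong refl)
      fix i assume "i \<in> {..?l}"
      then have "x ^ ?l * y ^ i = x ^ (?l - i) * (x ^ i * y ^ i)"
        by (simp flip: power_add mult.assoc)
      then show "coeff q i * x ^ (?l - i) = coeff q i * (x ^ ?l * y ^ i)" by (simp add: yx)
    qed
    also have "\<dots> = x ^ ?l * poly q y"
      by (simp add: poly_altdef sum_distrib_left mult_ac)
    finally have sx: "poly s x = 0" using qy by (simp add: s_def poly_monom)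
    have s: "coeff s i \<in> B" for i
      by (auto simp: s_def coeff_reflect_poly intro!: R(1-4) R(7)[OF q])
    \<comment> \<open>The factor \<open>1 - ?c\<close> changes the value at \<open>x\<close> to
      \<open>1 - ?c\<close>, and the constant \<open>?c\<close> restores \<open>1\<close>. The
      shifted multiple of \<open>s\<close> cancels the coefficient in degree \<open>?n\<close>,
      which is \<open>(1 - ?c) * coeff p ?n\<close>.\<close>
    define p' where "p' = smult (1 - ?c) p + [:?c:] + monom (coeff p ?n) (?n - ?l) * s"
    have "coeff p' i \<in> m" for i
    proof -
      have "coeff (monom (coeff p ?n) (?n - ?l) * s) i \<in> m"
        by (simp add: coeff_monom_mult R(8) R(11) p s)
      moreover have "(1 - ?c) * coeff p i \<in> m" by (rule R(10)[OF R(3)[OF R(1) R(7)[OF q]] p])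
      moreover have "coeff [:?c:] i \<in> m" using q R(8) by (cases i) auto
      ultimately show ?thesis using R(9) by (simp add: p'_def)
    qed
    moreover have "poly p' x = 1" using px sx by (simp add: p'_def)
    moreover have "degree p' < ?n"
    proof -
      have ds: "degree s \<le> ?l" unfolding s_def
        by (intro degree_diff_le degree_monom_le degree_reflect_poly_le)
      have "degree (monom (coeff p ?n) (?n - ?l) * s) \<le> ?n"
        using degree_mult_le[of "monom (coeff p ?n) (?n - ?l)" s] ds
          degree_monom_le[of "coeff p ?n" "?n - ?l"] le by linarith
      then have le': "degree p' \<le> ?n" unfolding p'_def
        by (intro degree_add_le degree_smult_le) auto
      have "coeff s ?l = ?c - 1" by (simp add: s_def coeff_reflect_poly)
      then have "coeff (monom (coeff p ?n) (?n - ?l) * s) ?n = coeff p ?n * (?c - 1)"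
        using le by (simp add: coeff_monom_mult)
      moreover have "coeff [:?c:] ?n = 0" using False by (cases ?n) auto
      ultimately have "coeff p' ?n = 0" by (simp add: p'_def algebra_simps)
      then show ?thesis using le' False
        by (metis degree_0 le_neq_implies_less leading_coeff_0_iff neq0_conv)
    qed
    ultimately show False using IH by blast
  qed
  show False
  proof (cases "degree q \<le> degree p")
    case True
    show ?thesis
    proof (rule red[OF less.prems True])
      fix p' assume "degree p' < degree p" and p': "\<And>i. coeff p' i \<in> m" "poly p' x = 1"
      then have "degree p' + degree q < degree p + degree q" by simp
      from less.hyps[OF this less.prems(1) p'(1) less.prems(3) p'(2) less.prems(5)] show False .
    qed
  next
    case False
    have yx: "y * x = 1" using less.prems(1) by (simp add: mult.commute)
    show ?thesis
    proof (rule red[OF yx less.prems(3,2,5,4)])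
      show "degree p \<le> degree q" using False by simp
      fix q' assume "degree q' < degree q" and q': "\<And>i. coeff q' i \<in> m" "poly q' y = 1"
      then have "degree p + degree q' < degree p + degree q" by simp
      from less.hyps[OF this less.prems(1,2) q'(1) less.prems(4) q'(2)] show False .
    qed
  qed
qed

text \<open>The polynomial expressions in \<open>x\<close> always form a ring and an ideal of it.
  Only properness can fail, and it fails exactly when \<open>1\<close> is such an expression with
  coefficients in \<open>m\<close>.\<close>

lemma ring_ideal_pair_adjoin:
  fixes x :: "'a::comm_ring_1"
  assumes pair: "ring_ideal_pair B m"
    and one: "\<And>p. (\<And>i. coeff p i \<in> m) \<Longrightarrow> poly p x \<noteq> 1"
  shows "ring_ideal_pair {poly p x |p. \<forall>i. coeff p i \<in> B} {poly p x |p. \<forall>i. coeff p i \<in> m}"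
    (is "ring_ideal_pair ?B ?m")
proof -
  note R = ring_ideal_pairD[OF pair]
  have mem: "poly p x \<in> ?B" if "\<And>i. coeff p i \<in> B" for p using that by blast
  have memm: "poly p x \<in> ?m" if "\<And>i. coeff p i \<in> m" for p using that by blast
  have "1 \<in> ?B" using mem[of 1] R(1,2) by simp
  moreover have "f - g \<in> ?B \<and> f * g \<in> ?B" if "f \<in> ?B" "g \<in> ?B" for f g
  proof -
    obtain p q where "f = poly p x" "g = poly q x" and c: "\<And>i. coeff p i \<in> B" "\<And>i. coeff q i \<in> B"
      using \<open>f \<in> ?B\<close> \<open>g \<in> ?B\<close> by blast
    then have "f - g = poly (p - q) x" "f * g = poly (p * q) x" by simp_all
    moreover have "coeff (p - q) i \<in> B" "coeff (p * q) i \<in> B" for i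
      unfolding coeff_diff coeff_mult using c
      by (auto intro!: R(3,6) ring_ideal_pair_sum(1)[OF pair])
    ultimately show ?thesis using mem[of "p - q"] mem[of "p * q"] by simp
  qed
  moreover have "?m \<subseteq> ?B" using R(7) by blast
  moreover have "0 \<in> ?m" using memm[of 0] R(8) by simp
  moreover have "f + g \<in> ?m" if "f \<in> ?m" "g \<in> ?m" for f g
  proof -
    obtain p q where "f = poly p x" "g = poly q x" and c: "\<And>i. coeff p i \<in> m" "\<And>i. coeff q i \<in> m"
      using \<open>f \<in> ?m\<close> \<open>g \<in> ?m\<close> by blast
    then show ?thesis using memm[of "p + q"] R(9) by simp
  qed
  moreover have "f * g \<in> ?m" if "f \<in> ?B" "g \<in> ?m" for f g
  proof -
    obtain p q where "f = poly p x" "g = poly q x" and c: "\<And>i. coeff p i \<in> B" "\<And>i. coeff q i \<in> m"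
      using \<open>f \<in> ?B\<close> \<open>g \<in> ?m\<close> by blast
    moreover have "coeff (p * q) i \<in> m" for i
      unfolding coeff_mult using c by (intro ring_ideal_pair_sum(2)[OF pair] R(10))
    ultimately show ?thesis using memm[of "p * q"] by simp
  qed
  moreover have "1 \<notin> ?m" using one by force
  ultimately show ?thesis by (rule ring_ideal_pairI)
qed

text \<open>Any two elements occur in a common member of the chain, where the closure conditions can
  be checked. Properness survives because \<open>1\<close> in the union would already lie in one of
  the ideals.\<close>

lemma ring_ideal_pair_Union:
  assumes "\<C> \<noteq> {}" and pair: "\<And>P. P \<in> \<C> \<Longrightarrow> ring_ideal_pair (fst P) (snd P)"
    and dir: "\<And>P Q. P \<in> \<C> \<Longrightarrow> Q \<in> \<C> \<Longrightarrow> (fst P \<subseteq> fst Q \<and> snd P \<subseteq> snd Q) \<or> (fst Q \<subseteq> fst P \<and> snd Q \<subseteq> snd P)"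
  shows "ring_ideal_pair (\<Union>P\<in>\<C>. fst P) (\<Union>P\<in>\<C>. snd P)"
proof -
  have two: "\<exists>R\<in>\<C>. fst P \<subseteq> fst R \<and> snd P \<subseteq> snd R \<and> fst Q \<subseteq> fst R \<and> snd Q \<subseteq> snd R"
    if "P \<in> \<C>" "Q \<in> \<C>" for P Q using dir[OF that] that by blast
  obtain P0 where P0: "P0 \<in> \<C>" using assms(1) by blast
  show ?thesis unfolding ring_ideal_pair_def
  proof (intro conjI ballI)
    show "1 \<in> (\<Union>P\<in>\<C>. fst P)" "0 \<in> (\<Union>P\<in>\<C>. snd P)"
      using P0 ring_ideal_pairD(1,8)[OF pair[OF P0]] by blast+
    show "(\<Union>P\<in>\<C>. snd P) \<subseteq> (\<Union>P\<in>\<C>. fst P)" using ring_ideal_pairD(7)[OF pair] by blast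
    show "1 \<notin> (\<Union>P\<in>\<C>. snd P)" using ring_ideal_pairD(14)[OF pair] by blast
  next
    fix x y assume "x \<in> (\<Union>P\<in>\<C>. fst P)" "y \<in> (\<Union>P\<in>\<C>. fst P)"
    then obtain P Q where "P \<in> \<C>" "Q \<in> \<C>" "x \<in> fst P" "y \<in> fst Q" by blast
    with two[of P Q] obtain R where "R \<in> \<C>" "x \<in> fst R" "y \<in> fst R" by blast
    then show "x - y \<in> (\<Union>P\<in>\<C>. fst P)" "x * y \<in> (\<Union>P\<in>\<C>. fst P)"
      by (auto intro!: bexI[of _ R] ring_ideal_pairD(3,6)[OF pair])
  next
    fix x y assume "x \<in> (\<Union>P\<in>\<C>. snd P)" "y \<in> (\<Union>P\<in>\<C>. snd P)"
    then obtain P Q where "P \<in> \<C>" "Q \<in> \<C>" "x \<in> snd P" "y \<in> snd Q" by blast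
    with two[of P Q] obtain R where "R \<in> \<C>" "x \<in> snd R" "y \<in> snd R" by blast
    then show "x + y \<in> (\<Union>P\<in>\<C>. snd P)"
      by (auto intro!: bexI[of _ R] ring_ideal_pairD(9)[OF pair])
  next
    fix x y assume "x \<in> (\<Union>P\<in>\<C>. fst P)" "y \<in> (\<Union>P\<in>\<C>. snd P)"
    then obtain P Q where "P \<in> \<C>" "Q \<in> \<C>" "x \<in> fst P" "y \<in> snd Q" by blast
    with two[of P Q] obtain R where "R \<in> \<C>" "x \<in> fst R" "y \<in> snd R" by blast
    then show "x * y \<in> (\<Union>P\<in>\<C>. snd P)"
      by (auto intro!: bexI[of _ R] ring_ideal_pairD(10)[OF pair])
  qed
qed

lemma ring_ideal_pair_maximal:
  fixes B m :: "'a::comm_ring_1 set"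
  assumes "ring_ideal_pair B m"
  obtains V n where "ring_ideal_pair V n" "B \<subseteq> V" "m \<subseteq> n"
    "\<And>V' n'. ring_ideal_pair V' n' \<Longrightarrow> V \<subseteq> V' \<Longrightarrow> n \<subseteq> n' \<Longrightarrow> V' = V \<and> n' = n"
proof -
  \<comment> \<open>The disjoint sum codes a pair as one set, so that Zorn's lemma for inclusion
    orders pairs componentwise.\<close>
  define \<A> where "\<A> = {V <+> n |V n. ring_ideal_pair V n \<and> B \<subseteq> V \<and> m \<subseteq> n}"
  have sub: "V <+> n \<subseteq> V' <+> n' \<longleftrightarrow> V \<subseteq> V' \<and> n \<subseteq> n'" for V V' n n' :: "'a set"
    by blast
  have "\<exists>M\<in>\<A>. \<forall>X\<in>\<A>. M \<subseteq> X \<longrightarrow> X = M"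
  proof (rule subset_Zorn_nonempty)
    show "\<A> \<noteq> {}" unfolding \<A>_def using assms by blast
    fix \<C> assume C: "\<C> \<noteq> {}" "subset.chain \<A> \<C>"
    define \<D> where "\<D> = {(V, n). ring_ideal_pair V n \<and> B \<subseteq> V \<and> m \<subseteq> n \<and> V <+> n \<in> \<C>}"
    have CA: "\<C> \<subseteq> \<A>" and ch: "\<And>X Y. X \<in> \<C> \<Longrightarrow> Y \<in> \<C> \<Longrightarrow> X \<subseteq> Y \<or> Y \<subseteq> X"
      using C(2) unfolding subset_chain_def by blast+
    have CD: "\<C> = (\<lambda>(V, n). V <+> n) ` \<D>"
    proof
      show "\<C> \<subseteq> (\<lambda>(V, n). V <+> n) ` \<D>"
      proof
        fix X assume "X \<in> \<C>"
        with CA have "X \<in> \<A>" by blast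
        then obtain V n where "X = V <+> n" "ring_ideal_pair V n" "B \<subseteq> V" "m \<subseteq> n"
          unfolding \<A>_def by blast
        with \<open>X \<in> \<C>\<close> show "X \<in> (\<lambda>(V, n). V <+> n) ` \<D>"
          by (intro image_eqI[of _ _ "(V, n)"]) (simp_all add: \<D>_def)
      qed
    qed (auto simp: \<D>_def)
    have ne: "\<D> \<noteq> {}" using C(1) CD by blast
    have "ring_ideal_pair (\<Union>P\<in>\<D>. fst P) (\<Union>P\<in>\<D>. snd P)"
    proof (rule ring_ideal_pair_Union[OF ne])
      show "ring_ideal_pair (fst P) (snd P)" if "P \<in> \<D>" for P using that by (auto simp: \<D>_def)
      fix P Q assume "P \<in> \<D>" "Q \<in> \<D>"
      then have "fst P <+> snd P \<in> \<C>" "fst Q <+> snd Q \<in> \<C>" by (simp_all add: \<D>_def case_prod_beta)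
      from ch[OF this] show "(fst P \<subseteq> fst Q \<and> snd P \<subseteq> snd Q) \<or> (fst Q \<subseteq> fst P \<and> snd Q \<subseteq> snd P)"
        by (simp only: sub)
    qed
    moreover have "B \<subseteq> (\<Union>P\<in>\<D>. fst P)" "m \<subseteq> (\<Union>P\<in>\<D>. snd P)"
    proof -
      obtain P where P: "P \<in> \<D>" using ne by blast
      then have "B \<subseteq> fst P" "m \<subseteq> snd P" by (simp_all add: \<D>_def case_prod_beta)
      with P show "B \<subseteq> (\<Union>P\<in>\<D>. fst P)" "m \<subseteq> (\<Union>P\<in>\<D>. snd P)" by blast+
    qed
    moreover have "\<Union>\<C> = (\<Union>P\<in>\<D>. fst P <+> snd P)"
      by (simp add: CD case_prod_beta)
    then have "\<Union>\<C> = (\<Union>P\<in>\<D>. fst P) <+> (\<Union>P\<in>\<D>. snd P)"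
      by (simp add: Plus_def UN_Un_distrib image_UN)
    ultimately show "\<Union>\<C> \<in> \<A>" unfolding \<A>_def by blast
  qed
  then obtain M where "M \<in> \<A>" and max: "\<And>X. X \<in> \<A> \<Longrightarrow> M \<subseteq> X \<Longrightarrow> X = M" by blast
  then obtain V n where M: "M = V <+> n" "ring_ideal_pair V n" "B \<subseteq> V" "m \<subseteq> n"
    unfolding \<A>_def by blast
  show ?thesis
  proof (rule that[OF M(2-4)])
    fix V' n' assume "ring_ideal_pair V' n'" "V \<subseteq> V'" "n \<subseteq> n'"
    then have "V' <+> n' \<in> \<A>" "M \<subseteq> V' <+> n'"
      unfolding \<A>_def M(1) sub
      by (intro CollectI exI[of _ V'] exI[of _ n'] conjI refl | use M in simp)+
    then have "V' <+> n' = V <+> n" using max M(1) by blast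
    then show "V' = V \<and> n' = n" by (metis sub order_refl subset_antisym)
  qed
qed

text \<open>Restricting attention to units makes Chevalley's theorem work in any commutative ring, so that
  a ring of functions can be used below instead of a field.\<close>
lemma valuation_pair_exists:
  fixes B m :: "'a::comm_ring_1 set"
  assumes "ring_ideal_pair B m"
  obtains V n where "ring_ideal_pair V n" "B \<subseteq> V" "m \<subseteq> n"
    "\<And>x y. x * y = 1 \<Longrightarrow> x \<notin> V \<Longrightarrow> y \<in> n"
proof -
  obtain V n where pair: "ring_ideal_pair V n" and sub: "B \<subseteq> V" "m \<subseteq> n"
    and max: "\<And>V' n'. ring_ideal_pair V' n' \<Longrightarrow> V \<subseteq> V' \<Longrightarrow> n \<subseteq> n' \<Longrightarrow> V' = V \<and> n' = n"
    by (rule ring_ideal_pair_maximal[OF assms, where thesis = thesis]) auto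
  note R = ring_ideal_pairD[OF pair]
  \<comment> \<open>By maximality, adjoining an element outside \<open>V\<close> must destroy
    properness.\<close>
  have ex: "\<exists>p. (\<forall>i. coeff p i \<in> n) \<and> poly p x = 1" if "x \<notin> V" for x
  proof (rule ccontr)
    assume "\<not> ?thesis"
    then have new: "ring_ideal_pair {poly p x |p. \<forall>i. coeff p i \<in> V} {poly p x |p. \<forall>i. coeff p i \<in> n}"
      (is "ring_ideal_pair ?V ?n")
      by (intro ring_ideal_pair_adjoin[OF pair]) blast
    have c: "f \<in> ?V" if "f \<in> V" for f
      using that R(2) by (intro CollectI exI[of _ "[:f:]"]) (auto simp: coeff_pCons split: nat.splits)
    have "f \<in> ?n" if "f \<in> n" for f
      using that R(8) by (intro CollectI exI[of _ "[:f:]"]) (auto simp: coeff_pCons split: nat.splits)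
    with c max[OF new] have "?V = V" by blast
    moreover have "x \<in> ?V"
      using R(1,2) by (intro CollectI exI[of _ "[:0, 1:]"]) (auto simp: coeff_pCons split: nat.splits)
    ultimately show False using that by simp
  qed
  show ?thesis
  proof (rule that[OF pair sub])
    fix x y :: 'a assume xy: "x * y = 1" and x: "x \<notin> V"
    obtain p where p: "\<And>i. coeff p i \<in> n" "poly p x = 1" using ex[OF x] by blast
    \<comment> \<open>Otherwise both \<open>x\<close> and \<open>y\<close> satisfy relations with
      coefficients in \<open>n\<close>, which the degree descent excludes.\<close>
    have y: "y \<in> V"
    proof (rule ccontr)
      assume "y \<notin> V"
      then obtain q where "\<And>i. coeff q i \<in> n" "poly q y = 1" using ex by blast
      with poly_ideal_unit_inverse[OF pair xy] p show False by blast
    qed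
    have yx: "x ^ j * y ^ j = 1" for j using xy by (simp flip: power_mult_distrib)
    let ?k = "degree p"
    \<comment> \<open>Multiplying the relation \<open>poly p x = 1\<close> by \<open>y ^ ?k\<close>
      removes all powers of \<open>x\<close> and shows that a power of \<open>y\<close> lies in
      \<open>n\<close>.\<close>
    have "y ^ ?k = (\<Sum>i\<le>?k. coeff p i * x ^ i) * y ^ ?k"
      using p(2) by (simp add: poly_altdef)
    also have "\<dots> = (\<Sum>i\<le>?k. coeff p i * y ^ (?k - i))"
      unfolding sum_distrib_right
    proof (intro sum.cong refl)
      fix i assume "i \<in> {..?k}"
      then have "y ^ ?k = y ^ i * y ^ (?k - i)" by (simp flip: power_add)
      then show "coeff p i * x ^ i * y ^ ?k = coeff p i * y ^ (?k - i)"
        using yx[of i] by (metis mult.assoc mult_1)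
    qed
    also have "\<dots> \<in> n"
      by (intro ring_ideal_pair_sum(2)[OF pair] R(11) p ring_ideal_pair_power[OF pair] y)
    finally have yk: "y ^ ?k \<in> n" .
    \<comment> \<open>If \<open>y\<close> were outside \<open>n\<close>, then \<open>y\<close> and
      \<open>n\<close> would generate the unit ideal by maximality, so that
      \<open>y * b = 1 - a\<close> with \<open>a\<close> in \<open>n\<close>. The power
      \<open>(1 - a) ^ ?k\<close> would lie in \<open>n\<close> and also be congruent to
      \<open>1\<close> modulo \<open>n\<close>.\<close>
    show "y \<in> n"
    proof (rule ccontr)
      assume yn: "y \<notin> n"
      let ?n = "{a + y * b |a b. a \<in> n \<and> b \<in> V}"
      have "\<exists>a\<in>n. \<exists>b\<in>V. a + y * b = 1"
      proof (rule ccontr)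
        assume no: "\<not> ?thesis"
        have "ring_ideal_pair V ?n" unfolding ring_ideal_pair_def
        proof (intro conjI ballI)
          show "?n \<subseteq> V" using R(5,6,7) y by blast
          show "0 \<in> ?n" using R(2,8) by force
          show "1 \<notin> ?n" using no by force
        next
          fix f g assume "f \<in> ?n" "g \<in> ?n"
          then obtain a b a' b' where "f = a + y * b" "g = a' + y * b'" "a \<in> n" "a' \<in> n" "b \<in> V" "b' \<in> V"
            by blast
          moreover from this have "f + g = (a + a') + y * (b + b')" by (simp add: algebra_simps)
          ultimately show "f + g \<in> ?n" using R(5)[of b b'] R(9)[of a a'] by blast
        next
          fix f g assume "f \<in> V" "g \<in> ?n"
          then obtain a b where "g = a + y * b" "a \<in> n" "b \<in> V" by blast
          moreover from this have "f * g = f * a + y * (f * b)" by (simp add: algebra_simps)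
          ultimately show "f * g \<in> ?n" using R(6)[of f b] R(10)[of f a] \<open>f \<in> V\<close> by blast
        qed (use R(1,3,6) in auto)
        moreover have "n \<subseteq> ?n" using R(2) by force
        ultimately have "?n = n" using max by blast
        moreover have "y \<in> ?n" using R(1,8) by (intro CollectI exI[of _ 0] exI[of _ 1]) auto
        ultimately show False using yn by simp
      qed
      then obtain a b where ab: "a \<in> n" "b \<in> V" "y * b = 1 - a" by (metis add_diff_cancel_left')
      have "(1 - a) ^ j - 1 \<in> n" for j
      proof (induction j)
        case (Suc j)
        have "(1 - a) ^ Suc j - 1 = ((1 - a) ^ j - 1) - a * (1 - a) ^ j" by (simp add: algebra_simps)
        moreover have "a * (1 - a) ^ j \<in> n"
          by (intro R(11) ab(1) ring_ideal_pair_power[OF pair] R(3) R(1) R(7))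
        ultimately show ?case using Suc R(13) by metis
      qed (simp add: R(8))
      moreover have "(1 - a) ^ ?k \<in> n"
        using yk ab R(11) ring_ideal_pair_power[OF pair ab(2)] by (metis power_mult_distrib)
      ultimately have "(1 - a) ^ ?k - ((1 - a) ^ ?k - 1) \<in> n" using R(13) by blast
      then show False using R(14) by simp
    qed
  qed
qed

section \<open>Linear algebra and linear inequalities\<close>

lemma exists_between_finite:
  fixes A B :: "real set"
  assumes "finite A" "finite B" "\<And>a b. a \<in> A \<Longrightarrow> b \<in> B \<Longrightarrow> a \<le> b"
  shows "\<exists>s. (\<forall>a\<in>A. a \<le> s) \<and> (\<forall>b\<in>B. s \<le> b)"
proof (cases "A = {}")
  case True
  then show ?thesis using assms(2) by (cases "B = {}") (auto intro!: exI[of _ "Min B"])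
next
  case False
  then show ?thesis using assms by (intro exI[of _ "Max A"]) auto
qed

text \<open>\<open>N\<close> stands for the monomials \<open>x\<^sup>a t\<^sup>b\<close> of nonnegative value in an arbitrary ordered group.
  The integrality of the coefficients \<open>a\<close> is essential: only integral combinations stay in \<open>N\<close>.\<close>
lemma fourier_motzkin:
  fixes N E :: "(('n::finite \<Rightarrow> int) \<times> real) set"
  assumes add: "\<And>a b a' b'. (a, b) \<in> N \<Longrightarrow> (a', b') \<in> N \<Longrightarrow> (\<lambda>j. a j + a' j, b + b') \<in> N"
    and const: "\<And>b. (\<lambda>_. 0, b) \<in> N \<Longrightarrow> 0 \<le> b"
    and "finite J"
  shows "finite E \<Longrightarrow> E \<subseteq> N \<Longrightarrow> (\<And>e j. e \<in> E \<Longrightarrow> j \<notin> J \<Longrightarrow> fst e j = 0) \<Longrightarrow>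
    \<exists>w. \<forall>e\<in>E. 0 \<le> snd e + (\<Sum>j\<in>UNIV. w j * of_int (fst e j))"
  using \<open>finite J\<close>
proof (induction J arbitrary: E rule: finite_induct)
  case empty
  have "0 \<le> snd e" and "fst e = (\<lambda>_. 0)" if "e \<in> E" for e
  proof -
    show "fst e = (\<lambda>_. 0)" using empty(3)[OF that] by auto
    then show "0 \<le> snd e" using const[of "snd e"] empty(2) that by (metis prod.collapse subsetD)
  qed
  then show ?case by auto
next
  case (insert j J)
  have scale: "(\<lambda>l. int n * a l, real n * b) \<in> N" if "(a, b) \<in> N" "n > 0" for a b n
    using that(2,1)
  proof (induction n rule: nat_induct_non_zero)
    case (Suc n)
    show ?case using add[OF Suc.prems Suc.IH[OF Suc.prems]] by (simp add: algebra_simps)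
  qed simp
  have scale: "(\<lambda>l. k * a l, of_int k * b) \<in> N" if "(a, b) \<in> N" "k > 0" for a b k
    using scale[OF that(1), of "nat k"] that(2) by simp
  \<comment> \<open>For \<open>e\<close> positive and \<open>e'\<close> negative at
    \<open>j\<close>, this is the combination with positive integer multipliers in which coordinate
    \<open>j\<close> cancels.\<close>
  define cmb :: "('n \<Rightarrow> int) \<times> real \<Rightarrow> ('n \<Rightarrow> int) \<times> real \<Rightarrow> ('n \<Rightarrow> int) \<times> real" where
    "cmb e e' = (\<lambda>l. fst e j * fst e' l + (- fst e' j) * fst e l,
       of_int (fst e j) * snd e' + of_int (- fst e' j) * snd e)" for e e'
  define P where "P = {e \<in> E. fst e j > 0}"
  define M where "M = {e \<in> E. fst e j < 0}"
  define E' where "E' = {e \<in> E. fst e j = 0} \<union> (\<lambda>(e, e'). cmb e e') ` (P \<times> M)"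
  have fin: "finite P" "finite M" "finite E'"
    using insert.prems(1) by (auto simp: P_def M_def E'_def)
  have "cmb e e' \<in> N" if "e \<in> P" "e' \<in> M" for e e'
  proof -
    have "(fst e, snd e) \<in> N" "(fst e', snd e') \<in> N" "fst e j > 0" "- fst e' j > 0"
      using that insert.prems(2) by (auto simp: P_def M_def)
    then show ?thesis unfolding cmb_def by (intro add scale)
  qed
  then have "E' \<subseteq> N" using insert.prems(2) by (auto simp: E'_def)
  moreover have "fst e l = 0" if "e \<in> E'" "l \<notin> J" for e l
  proof (cases "l = j")
    case True
    then show ?thesis using that by (auto simp: E'_def cmb_def)
  next
    case False
    then have z: "fst e0 l = 0" if "e0 \<in> E" for e0
      using insert.prems(3)[OF that, of l] \<open>l \<notin> J\<close> by simp
    from \<open>e \<in> E'\<close> have "e \<in> E \<or> (\<exists>e1\<in>P. \<exists>e2\<in>M. e = cmb e1 e2)"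
      by (simp add: E'_def image_iff) metis
    then show ?thesis
    proof (elim disjE bexE)
      fix e1 e2 assume "e1 \<in> P" "e2 \<in> M" "e = cmb e1 e2"
      then show ?thesis using z[of e1] z[of e2] by (simp add: cmb_def P_def M_def)
    qed (rule z)
  qed
  ultimately obtain w where w: "\<And>e. e \<in> E' \<Longrightarrow> 0 \<le> snd e + (\<Sum>j\<in>UNIV. w j * of_int (fst e j))"
    using insert.IH[OF fin(3)] by blast
  define \<phi> where "\<phi> e = snd e + (\<Sum>j\<in>UNIV. w j * of_int (fst e j))" for e
  have cmb_ge: "0 \<le> of_int (fst e j) * \<phi> e' - of_int (fst e' j) * \<phi> e" if "e \<in> P" "e' \<in> M" for e e'
  proof -
    have "0 \<le> \<phi> (cmb e e')" using w[of "cmb e e'"] that by (auto simp: E'_def \<phi>_def)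
    also have "\<phi> (cmb e e') = of_int (fst e j) * \<phi> e' - of_int (fst e' j) * \<phi> e"
      by (simp add: \<phi>_def cmb_def algebra_simps sum.distrib sum_distrib_left sum_subtractf)
    finally show ?thesis .
  qed
  \<comment> \<open>Replacing \<open>w j\<close> by \<open>w j + s\<close> adds
    \<open>s * fst e j\<close> to the value of \<open>e\<close>. Members of \<open>P\<close>
    therefore bound \<open>s\<close> from below and members of \<open>M\<close> from above;
    \<open>cmb_ge\<close> makes the bounds compatible.\<close>
  have "\<exists>s. (\<forall>a\<in>(\<lambda>e. - \<phi> e / of_int (fst e j)) ` P. a \<le> s) \<and> (\<forall>b\<in>(\<lambda>e. - \<phi> e / of_int (fst e j)) ` M. s \<le> b)"
  proof (rule exists_between_finite)
    fix a b assume "a \<in> (\<lambda>e. - \<phi> e / of_int (fst e j)) ` P" "b \<in> (\<lambda>e. - \<phi> e / of_int (fst e j)) ` M"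
    then obtain e e' where e: "e \<in> P" "e' \<in> M" "a = - \<phi> e / of_int (fst e j)" "b = - \<phi> e' / of_int (fst e' j)"
      by blast
    have "real_of_int (fst e j) > 0" "real_of_int (fst e' j) < 0" using e by (auto simp: P_def M_def)
    then show "a \<le> b" using cmb_ge[OF e(1,2)] unfolding e(3,4) by (simp add: field_simps)
  qed (use fin in auto)
  then obtain s where s: "\<And>e. e \<in> P \<Longrightarrow> - \<phi> e / of_int (fst e j) \<le> s" "\<And>e. e \<in> M \<Longrightarrow> s \<le> - \<phi> e / of_int (fst e j)"
    by auto
  have "0 \<le> snd e + (\<Sum>l\<in>UNIV. (w(j := w j + s)) l * of_int (fst e l))" if "e \<in> E" for e
  proof -
    have "(\<Sum>l\<in>UNIV. (w(j := w j + s)) l * of_int (fst e l))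
      = (\<Sum>l\<in>UNIV. w l * of_int (fst e l) + (if l = j then s * of_int (fst e j) else 0))"
      by (intro sum.cong) (auto simp: algebra_simps)
    then have "snd e + (\<Sum>l\<in>UNIV. (w(j := w j + s)) l * of_int (fst e l)) = \<phi> e + s * of_int (fst e j)"
      by (simp add: sum.distrib \<phi>_def)
    moreover have "0 \<le> \<phi> e + s * of_int (fst e j)"
    proof (cases "fst e j" "0 :: int" rule: linorder_cases)
      case less
      then have "real_of_int (fst e j) < 0" by simp
      with s(2)[of e] that less show ?thesis by (simp add: M_def field_simps)
    next
      case equal
      then have "e \<in> E'" using that by (simp add: E'_def)
      then show ?thesis using w equal by (simp add: \<phi>_def)
    next
      case greater
      then have "real_of_int (fst e j) > 0" by simp
      with s(1)[of e] that greater show ?thesis by (simp add: P_def field_simps)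
    qed
    ultimately show ?thesis by simp
  qed
  then show ?case by blast
qed

text \<open>On \<open>W\<close>, coordinate \<open>i\<close> vanishes wherever all coordinates in
  \<open>J\<close> vanish, so there it is a linear combination of them. The coefficients of this
  dependence form \<open>d\<close>.\<close>

lemma annihilator_exists:
  fixes W :: "('i \<Rightarrow> 'a::field) set"
  assumes "finite J" "i \<notin> J"
    and "\<And>f g c. f \<in> W \<Longrightarrow> g \<in> W \<Longrightarrow> (\<lambda>l. f l - c * g l) \<in> W"
    and "\<And>f. f \<in> W \<Longrightarrow> f i \<noteq> 0 \<Longrightarrow> \<exists>j\<in>J. f j \<noteq> 0"
  shows "\<exists>d. d i = 1 \<and> (\<forall>l. l \<notin> insert i J \<longrightarrow> d l = 0) \<and> (\<forall>f\<in>W. (\<Sum>l\<in>insert i J. d l * f l) = 0)"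
  using assms
proof (induction J arbitrary: W rule: finite_induct)
  case empty
  then show ?case by (intro exI[of _ "\<lambda>l. if l = i then 1 else 0"]) auto
next
  case (insert j J)
  have ij: "i \<noteq> j" "i \<notin> J" using insert.prems by auto
  show ?case
  proof (cases "\<forall>f\<in>W. f j = 0")
    case True
    obtain d where d: "d i = 1" "\<And>l. l \<notin> insert i J \<Longrightarrow> d l = 0" "\<And>f. f \<in> W \<Longrightarrow> (\<Sum>l\<in>insert i J. d l * f l) = 0"
      using insert.IH[OF ij(2), of W] insert.prems True by fastforce
    moreover have "(\<Sum>l\<in>insert i (insert j J). d l * f l) = 0" if "f \<in> W" for f
      using d(3)[OF that] bspec[OF True that] insert.hyps ij by simp
    ultimately show ?thesis by blast
  next
    case False
    then obtain p where p: "p \<in> W" "p j \<noteq> 0" by blast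
    have "\<exists>d. d i = 1 \<and> (\<forall>l. l \<notin> insert i J \<longrightarrow> d l = 0) \<and>
      (\<forall>f\<in>{f \<in> W. f j = 0}. (\<Sum>l\<in>insert i J. d l * f l) = 0)"
      using insert.prems(2,3) by (intro insert.IH[OF ij(2)]) auto
    then obtain d where d: "d i = 1" "\<And>l. l \<notin> insert i J \<Longrightarrow> d l = 0"
      "\<And>f. f \<in> W \<Longrightarrow> f j = 0 \<Longrightarrow> (\<Sum>l\<in>insert i J. d l * f l) = 0"
      by blast
    define S where "S f = (\<Sum>l\<in>insert i J. d l * f l)" for f
    \<comment> \<open>Subtracting a multiple of \<open>p\<close> moves any \<open>f\<close> in
      \<open>W\<close> to the subspace where coordinate \<open>j\<close> vanishes, on which
      \<open>d\<close> already works. The value at \<open>j\<close> is chosen so that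
      \<open>p\<close> is annihilated too.\<close>
    define d' where "d' = d(j := - S p / p j)"
    have "(\<Sum>l\<in>insert i (insert j J). d' l * f l) = 0" if "f \<in> W" for f
    proof -
      have "S (\<lambda>l. f l - f j / p j * p l) = 0"
        unfolding S_def using insert.prems(2)[OF that p(1), of "f j / p j"] p(2)
        by (intro d(3)) auto
      then have *: "S f = f j / p j * S p"
        by (simp add: S_def right_diff_distrib sum_subtractf sum_distrib_left mult_ac del: sum.insert)
      have "(\<Sum>l\<in>insert i (insert j J). d' l * f l) = (\<Sum>l\<in>insert j (insert i J). d' l * f l)"
        by (simp add: insert_commute)
      also have "\<dots> = d' j * f j + (\<Sum>l\<in>insert i J. d' l * f l)"
        by (rule sum.insert) (use insert.hyps ij in auto)
      also have "(\<Sum>l\<in>insert i J. d' l * f l) = S f"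
        unfolding S_def by (rule sum.cong) (use insert.hyps ij in \<open>auto simp: d'_def\<close>)
      finally show ?thesis using * by (simp add: d'_def)
    qed
    moreover have "d' i = 1" "\<And>l. l \<notin> insert i (insert j J) \<Longrightarrow> d' l = 0"
      using d ij by (auto simp: d'_def)
    ultimately show ?thesis by blast
  qed
qed

text \<open>A vector space over an infinite field is not a finite union of proper subspaces: on the
  line \<open>d + c d'\<close> each coordinate excludes at most one \<open>c\<close>.\<close>

lemma generic_vector_exists:
  fixes L :: "('i \<Rightarrow> complex) set"
  assumes "finite J" "L \<noteq> {}"
    and lin: "\<And>f g c. f \<in> L \<Longrightarrow> g \<in> L \<Longrightarrow> (\<lambda>l. f l + c * g l) \<in> L"
    and "\<And>j. j \<in> J \<Longrightarrow> \<exists>d\<in>L. d j \<noteq> 0"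
  shows "\<exists>d\<in>L. \<forall>j\<in>J. d j \<noteq> 0"
  using assms(1,4)
proof (induction J rule: finite_induct)
  case empty
  then show ?case using assms(2) by auto
next
  case (insert j J)
  then obtain d where d: "d \<in> L" "\<And>l. l \<in> J \<Longrightarrow> d l \<noteq> 0" by blast
  obtain d' where d': "d' \<in> L" "d' j \<noteq> 0" using insert.prems by auto
  obtain c where c: "c \<notin> (\<lambda>l. - d l / d' l) ` insert j J"
    using ex_new_if_finite[OF infinite_UNIV_char_0, of "(\<lambda>l. - d l / d' l) ` insert j J"] insert.hyps(1)
    by auto
  have "d l + c * d' l \<noteq> 0" if l: "l \<in> insert j J" for l
  proof (cases "d' l = 0")
    case True
    then show ?thesis using l d(2) d'(2) by auto
  next
    case False
    then have "c \<noteq> - d l / d' l" using c l by blast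
    then show ?thesis
      using False by (metis add.commute eq_neg_iff_add_eq_0 nonzero_mult_div_cancel_right)
  qed
  then show ?case by (intro bexI[OF _ lin[OF d(1) d'(1), of c]] ballI)
qed

section \<open>Initial forms along real curves\<close>

lemma tendsto_powr_at_right_0:
  assumes "0 < a"
  shows "((\<lambda>t. complex_of_real (t powr a)) \<longlongrightarrow> 0) (at_right 0)"
proof -
  have "((\<lambda>t::real. t powr a) \<longlongrightarrow> 0) (at_right 0)"
    using assms by (intro tendsto_zero_powrI[of _ _ _ a]) (auto intro: tendsto_ident_at eventually_at_right_less[THEN eventually_mono])
  from tendsto_of_real[OF this] show ?thesis by simp
qed

text \<open>Dividing by the smallest power and letting \<open>t\<close> tend to 0 isolates its
  coefficient, so the exponents are removed from the bottom.\<close>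

lemma powr_linear_independent:
  fixes b :: "real \<Rightarrow> complex"
  assumes "finite \<Gamma>" and "\<And>t. 0 < t \<Longrightarrow> (\<Sum>\<gamma>\<in>\<Gamma>. b \<gamma> * of_real (t powr \<gamma>)) = 0" and "\<gamma> \<in> \<Gamma>"
  shows "b \<gamma> = 0"
  using assms
proof (induction \<Gamma> rule: finite_linorder_min_induct)
  case (insert \<delta> A)
  have "((\<lambda>t. \<Sum>\<gamma>\<in>A. b \<gamma> * of_real (t powr (\<gamma> - \<delta>))) \<longlongrightarrow> (\<Sum>\<gamma>\<in>A. b \<gamma> * 0)) (at_right 0)"
    using insert.hyps(2) by (intro tendsto_intros tendsto_powr_at_right_0) auto
  moreover have "(\<Sum>\<gamma>\<in>A. b \<gamma> * of_real (t powr (\<gamma> - \<delta>))) = - b \<delta>" if "0 < t" for t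
  proof -
    have "(\<Sum>\<gamma>\<in>A. b \<gamma> * of_real (t powr \<gamma>)) + b \<delta> * of_real (t powr \<delta>) = 0"
      using insert.prems(1)[OF that] insert.hyps by (auto simp: add.commute)
    then have "(\<Sum>\<gamma>\<in>A. b \<gamma> * of_real (t powr \<gamma>)) = - b \<delta> * of_real (t powr \<delta>)"
      by (simp add: eq_neg_iff_add_eq_0)
    moreover have "(\<Sum>\<gamma>\<in>A. b \<gamma> * of_real (t powr (\<gamma> - \<delta>))) = (\<Sum>\<gamma>\<in>A. b \<gamma> * of_real (t powr \<gamma>)) / of_real (t powr \<delta>)"
      by (simp add: powr_diff sum_divide_distrib)
    ultimately show ?thesis using that by simp
  qed
  ultimately have "((\<lambda>t. - b \<delta>) \<longlongrightarrow> 0) (at_right (0::real))"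
    using eventually_at_right_less[of 0]
    by (auto elim!: Lim_transform_eventually elim: eventually_mono)
  then have *: "b \<delta> = 0" by (simp add: tendsto_const_iff trivial_limit_at_right_real)
  have "b \<gamma> = 0" if "\<gamma> \<in> A"
  proof (rule insert.IH[OF _ that])
    fix t :: real assume "0 < t"
    from insert.prems(1)[OF this] show "(\<Sum>\<gamma>\<in>A. b \<gamma> * of_real (t powr \<gamma>)) = 0"
      using insert.hyps * by (subst (asm) sum.insert) auto
  qed
  then show ?case using * insert.prems(2) by blast
qed simp

text \<open>Suppose that the initial form is the single term with exponent \<alpha>. Divided by the
  power of \<open>t\<close> that belongs to \<alpha>, the value of \<open>F\<close> along the curve
  tends to \<open>F \<alpha>\<close> times a monomial in the nonzero numbers \<open>C i\<close>,
  although it is eventually zero.\<close>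

lemma curve_excludes_monomial_initial_form:
  fixes c :: "real \<Rightarrow> 'i::finite \<Rightarrow> complex"
  assumes lim: "\<And>i. ((\<lambda>t. c t i / of_real (t powr u i)) \<longlongrightarrow> C i) (at_right 0)" and C: "\<And>i. C i \<noteq> 0"
    and F: "mpoly_fin F" "\<forall>\<^sub>F t in at_right 0. mpoly_eval F (c t) = 0"
  shows "\<not> initial_is_monomial u F"
proof
  define wt where "wt \<alpha> = (\<Sum>v\<in>UNIV. real (\<alpha> v) * u v)" for \<alpha> :: "'i \<Rightarrow> nat"
  assume "initial_is_monomial u F"
  then obtain \<alpha> where \<alpha>: "F \<alpha> \<noteq> 0" "\<And>\<beta>. F \<beta> \<noteq> 0 \<Longrightarrow> \<beta> \<noteq> \<alpha> \<Longrightarrow> wt \<alpha> < wt \<beta>"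
    unfolding initial_is_monomial_def wt_def by blast
  define g where "g t i = c t i / of_real (t powr u i)" for t i
  let ?S = "{\<beta>. F \<beta> \<noteq> 0}"
  have fin: "finite ?S" using F(1) by (simp add: mpoly_fin_def)
  have mon_eq: "(\<Prod>v\<in>UNIV. c t v ^ \<beta> v) = (\<Prod>v\<in>UNIV. g t v ^ \<beta> v) * of_real (t powr wt \<beta>)" if "0 < t" for t \<beta>
  proof -
    have "(\<Prod>v\<in>UNIV. c t v ^ \<beta> v) = (\<Prod>v\<in>UNIV. g t v ^ \<beta> v * of_real (t powr (real (\<beta> v) * u v)))"
    proof (intro prod.cong refl)
      fix v
      have "(t powr u v) ^ \<beta> v = t powr (real (\<beta> v) * u v)"
        using that by (simp add: powr_power mult.commute)
      moreover have "c t v = g t v * of_real (t powr u v)" using that by (simp add: g_def)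
      ultimately show "c t v ^ \<beta> v = g t v ^ \<beta> v * of_real (t powr (real (\<beta> v) * u v))"
        by (metis of_real_power power_mult_distrib)
    qed
    also have "\<dots> = (\<Prod>v\<in>UNIV. g t v ^ \<beta> v) * of_real (t powr wt \<beta>)"
      using that by (simp add: prod.distrib wt_def powr_sum flip: of_real_prod)
    finally show ?thesis .
  qed
  have sum0: "(\<Sum>\<beta>\<in>?S. F \<beta> * (\<Prod>v\<in>UNIV. g t v ^ \<beta> v) * of_real (t powr (wt \<beta> - wt \<alpha>))) = 0"
    if "0 < t" "mpoly_eval F (c t) = 0" for t
  proof -
    have "(\<Sum>\<beta>\<in>?S. F \<beta> * (\<Prod>v\<in>UNIV. g t v ^ \<beta> v) * of_real (t powr (wt \<beta> - wt \<alpha>)))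
      = (\<Sum>\<beta>\<in>?S. F \<beta> * (\<Prod>v\<in>UNIV. c t v ^ \<beta> v)) / of_real (t powr wt \<alpha>)"
      using mon_eq[OF that(1)] by (simp add: powr_diff sum_divide_distrib mult.assoc)
    then show ?thesis using that(2) by (simp add: mpoly_eval_def)
  qed
  have l: "((\<lambda>t. \<Sum>\<beta>\<in>?S. F \<beta> * (\<Prod>v\<in>UNIV. g t v ^ \<beta> v) * of_real (t powr (wt \<beta> - wt \<alpha>)))
    \<longlongrightarrow> (\<Sum>\<beta>\<in>?S. F \<beta> * (\<Prod>v\<in>UNIV. C v ^ \<beta> v) * (if \<beta> = \<alpha> then 1 else 0))) (at_right 0)"
  proof (intro tendsto_sum tendsto_mult tendsto_const tendsto_prod tendsto_power)
    show "((\<lambda>t. g t v) \<longlongrightarrow> C v) (at_right 0)" for v using lim by (simp add: g_def)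
    fix \<beta> assume "\<beta> \<in> ?S"
    show "((\<lambda>t. complex_of_real (t powr (wt \<beta> - wt \<alpha>))) \<longlongrightarrow> (if \<beta> = \<alpha> then 1 else 0)) (at_right 0)"
    proof (cases "\<beta> = \<alpha>")
      case True
      have "\<forall>\<^sub>F t in at_right (0::real). 1 = complex_of_real (t powr (wt \<beta> - wt \<alpha>))"
        using True by (auto intro!: eventually_at_right_less[THEN eventually_mono])
      then show ?thesis using True by (auto intro: Lim_transform_eventually[OF tendsto_const])
    next
      case False
      then show ?thesis using \<alpha>(2)[of \<beta>] \<open>\<beta> \<in> ?S\<close> by (simp add: tendsto_powr_at_right_0)
    qed
  qed
  have c: "(\<Sum>\<beta>\<in>?S. F \<beta> * (\<Prod>v\<in>UNIV. C v ^ \<beta> v) * (if \<beta> = \<alpha> then 1 else 0)) = F \<alpha> * (\<Prod>v\<in>UNIV. C v ^ \<alpha> v)"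
    using fin \<alpha>(1) by (simp add: sum.delta if_distrib[of "\<lambda>x. _ * x"] cong: if_cong)
  have e: "\<forall>\<^sub>F t in at_right 0. (\<Sum>\<beta>\<in>?S. F \<beta> * (\<Prod>v\<in>UNIV. g t v ^ \<beta> v) * of_real (t powr (wt \<beta> - wt \<alpha>))) = 0"
    using eventually_at_right_less[of 0] F(2) by eventually_elim (rule sum0)
  have "((\<lambda>t. 0) \<longlongrightarrow> F \<alpha> * (\<Prod>v\<in>UNIV. C v ^ \<alpha> v)) (at_right (0::real))"
    using Lim_transform_eventually[OF l e] unfolding c .
  then have "F \<alpha> * (\<Prod>v\<in>UNIV. C v ^ \<alpha> v) = 0"
    by (simp add: tendsto_const_iff trivial_limit_at_right_real)
  then show False using \<alpha>(1) C by simp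
qed

section \<open>Osculating conditions as linear conditions\<close>

text \<open>Only finite sums are formed. Scalars and signs are built into the generating sets used
  below, so the spans become linear subspaces, subrings or ideals.\<close>

inductive_set add_span :: "'a::comm_monoid_add set \<Rightarrow> 'a set" for G where
  zero: "0 \<in> add_span G"
| step: "g \<in> G \<Longrightarrow> h \<in> add_span G \<Longrightarrow> g + h \<in> add_span G"

lemma add_span_base: "g \<in> G \<Longrightarrow> g \<in> add_span G"
  using add_span.step[OF _ add_span.zero] by fastforce

lemma add_span_add: "f \<in> add_span G \<Longrightarrow> g \<in> add_span G \<Longrightarrow> f + g \<in> add_span G"
  by (induction rule: add_span.induct) (auto simp: add.assoc intro: add_span.step)

lemma add_span_sum: "(\<And>i. i \<in> A \<Longrightarrow> f i \<in> add_span G) \<Longrightarrow> sum f A \<in> add_span G"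
  by (induction A rule: infinite_finite_induct) (auto intro: add_span_add add_span.zero)

lemma add_span_image:
  assumes "f \<in> add_span G" "\<phi> 0 = 0" "\<And>f g. \<phi> (f + g) = \<phi> f + \<phi> g" "\<And>g. g \<in> G \<Longrightarrow> \<phi> g \<in> add_span H"
  shows "\<phi> f \<in> add_span H"
  using assms(1) by (induction rule: add_span.induct) (auto simp: assms(2-4) intro: add_span_add add_span.zero)

lemma add_span_mono: "G \<subseteq> H \<Longrightarrow> add_span G \<subseteq> add_span H"
  using add_span_image[where \<phi> = "\<lambda>x. x"] add_span_base by blast

section \<open>Value vectors of polynomials of bounded degree\<close>

lemma mpoly_eval_superset:
  assumes "finite A" "{\<alpha>. F \<alpha> \<noteq> 0} \<subseteq> A"
  shows "mpoly_eval F c = (\<Sum>\<alpha>\<in>A. F \<alpha> * (\<Prod>v\<in>UNIV. c v ^ \<alpha> v))"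
  unfolding mpoly_eval_def by (rule sum.mono_neutral_left) (use assms in auto)

lemma mpoly_eval_diff_smult:
  fixes P Q :: "('v::finite \<Rightarrow> nat) \<Rightarrow> 'a::comm_ring_1"
  assumes "mpoly_fin P" "mpoly_fin Q"
  shows "mpoly_eval (\<lambda>\<alpha>. P \<alpha> - c * Q \<alpha>) x = mpoly_eval P x - c * mpoly_eval Q x"
    and "mpoly_fin (\<lambda>\<alpha>. P \<alpha> - c * Q \<alpha>)"
proof -
  let ?A = "{\<alpha>. P \<alpha> \<noteq> 0} \<union> {\<alpha>. Q \<alpha> \<noteq> 0}"
  have fin: "finite ?A" using assms by (simp add: mpoly_fin_def)
  have sub: "{\<alpha>. P \<alpha> - c * Q \<alpha> \<noteq> 0} \<subseteq> ?A" by auto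
  show "mpoly_fin (\<lambda>\<alpha>. P \<alpha> - c * Q \<alpha>)"
    using finite_subset[OF sub fin] by (simp add: mpoly_fin_def)
  have "mpoly_eval P x = (\<Sum>\<alpha>\<in>?A. P \<alpha> * (\<Prod>v\<in>UNIV. x v ^ \<alpha> v))"
    "mpoly_eval Q x = (\<Sum>\<alpha>\<in>?A. Q \<alpha> * (\<Prod>v\<in>UNIV. x v ^ \<alpha> v))"
    by (rule mpoly_eval_superset[OF fin]; blast)+
  then show "mpoly_eval (\<lambda>\<alpha>. P \<alpha> - c * Q \<alpha>) x = mpoly_eval P x - c * mpoly_eval Q x"
    by (simp add: mpoly_eval_superset[OF fin sub] left_diff_distrib sum_subtractf sum_distrib_left mult.assoc)
qed

definition filtered_gens :: "(('n::finite \<Rightarrow> nat) \<Rightarrow> 'i \<Rightarrow> rat) \<Rightarrow> nat \<Rightarrow> ('i \<Rightarrow> rat) set" where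
  "filtered_gens h k = {\<lambda>i. c * h \<beta> i |c \<beta>. sum \<beta> UNIV \<le> k}"

lemma filtered_gens_mono: "k \<le> l \<Longrightarrow> filtered_gens h k \<subseteq> filtered_gens h l"
  by (force simp: filtered_gens_def)

lemma filtered_gensI: "sum \<beta> UNIV \<le> k \<Longrightarrow> (\<lambda>i. c * h \<beta> i) \<in> filtered_gens h k"
  by (auto simp: filtered_gens_def)

text \<open>Covers both monomials (\<open>s = 0\<close>) and products of falling factorials (\<open>s \<alpha> j = \<alpha> j\<close>),
  so that the two families span the same spaces.\<close>
lemma filtered_gens_change_basis:
  fixes g h :: "('n::finite \<Rightarrow> nat) \<Rightarrow> 'i \<Rightarrow> rat"
  assumes g0: "\<And>i. g (\<lambda>_. 0) i = 1" and gs: "\<And>\<alpha> j i. g (\<alpha>(j := Suc (\<alpha> j))) i = (x i j - s \<alpha> j) * g \<alpha> i"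
    and h0: "\<And>i. h (\<lambda>_. 0) i = 1" and hs: "\<And>\<alpha> j i. h (\<alpha>(j := Suc (\<alpha> j))) i = (x i j - s' \<alpha> j) * h \<alpha> i"
  shows "add_span (filtered_gens g k) \<subseteq> add_span (filtered_gens h k)"
proof -
  have sum_upd: "sum (\<alpha>(j := Suc (\<alpha> j))) UNIV = Suc (sum \<alpha> UNIV)" for \<alpha> :: "'n \<Rightarrow> nat" and j
    by (simp add: sum.remove[of UNIV j])
  have mult: "(\<lambda>i. (x i j - t) * f i) \<in> add_span (filtered_gens h (Suc n))"
    if "f \<in> add_span (filtered_gens h n)" for f j n t
  proof (rule add_span_image[OF that])
    fix q assume "q \<in> filtered_gens h n"
    then obtain c \<beta> where q: "q = (\<lambda>i. c * h \<beta> i)" "sum \<beta> UNIV \<le> n" by (auto simp: filtered_gens_def)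
    \<comment> \<open>The linear factor is split as
      \<open>(x i j - s' \<beta> j) + (s' \<beta> j - t)\<close>: the first part raises the exponent
      at \<open>j\<close> by one, the second is a scalar.\<close>
    have "(\<lambda>i. (x i j - t) * q i)
      = (\<lambda>i. c * h (\<beta>(j := Suc (\<beta> j))) i) + (\<lambda>i. (c * (s' \<beta> j - t)) * h \<beta> i)"
      by (auto simp: q hs algebra_simps)
    also have "\<dots> \<in> add_span (filtered_gens h (Suc n))"
      using q(2) by (intro add_span_add add_span_base filtered_gensI) (simp_all add: sum_upd del: fun_upd_apply)
    finally show "(\<lambda>i. (x i j - t) * q i) \<in> add_span (filtered_gens h (Suc n))" .
  qed (auto simp: algebra_simps)
  have "(\<lambda>i. a * g \<alpha> i) \<in> add_span (filtered_gens h n)" if "sum \<alpha> UNIV = n" for a \<alpha> n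
    using that
  proof (induction n arbitrary: \<alpha>)
    case 0
    then have "\<alpha> = (\<lambda>_. 0)" by auto
    then have "(\<lambda>i. a * g \<alpha> i) = (\<lambda>i. a * h (\<lambda>_. 0) i)" by (simp add: g0 h0)
    then show ?case by (simp add: add_span_base filtered_gensI)
  next
    case (Suc n)
    then obtain j where "\<alpha> j \<noteq> 0" by (metis sum.neutral nat.simps(3))
    define \<beta> where "\<beta> = \<alpha>(j := \<alpha> j - 1)"
    have \<alpha>: "\<alpha> = \<beta>(j := Suc (\<beta> j))" using \<open>\<alpha> j \<noteq> 0\<close> by (auto simp: \<beta>_def)
    then have "sum \<beta> UNIV = n" using Suc.prems sum_upd[of \<beta> j] by (simp del: fun_upd_apply)
    from mult[OF Suc.IH[OF this], of j "s \<beta> j"] show ?case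
      by (subst \<alpha>) (simp add: gs mult_ac)
  qed
  then have "g' \<in> add_span (filtered_gens h k)" if "g' \<in> filtered_gens g k" for g'
    using that add_span_mono[OF filtered_gens_mono] unfolding filtered_gens_def[of g] by blast
  then show ?thesis using add_span_image[where \<phi> = "\<lambda>x. x"] by blast
qed

definition monomial_at :: "('i \<Rightarrow> 'n::finite \<Rightarrow> int) \<Rightarrow> ('n \<Rightarrow> nat) \<Rightarrow> 'i \<Rightarrow> rat" where
  "monomial_at r \<alpha> i = (\<Prod>j\<in>UNIV. of_int (r i j) ^ \<alpha> j)"

text \<open>The rational form of the scalar that the partial derivative of order \<alpha> puts in
  front of a monomial in \<open>osc_vec\<close>.\<close>

definition falling_at :: "('i \<Rightarrow> 'n::finite \<Rightarrow> int) \<Rightarrow> ('n \<Rightarrow> nat) \<Rightarrow> 'i \<Rightarrow> rat" where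
  "falling_at r \<alpha> i = (\<Prod>j\<in>UNIV. \<Prod>t<\<alpha> j. of_int (r i j) - of_nat t)"

text \<open>This space links the two sides of the theorem: its orthogonal complement describes
  osculation, and the supports of its members are the index sets of the Euler derivatives.\<close>

definition poly_values :: "('i \<Rightarrow> 'n::finite \<Rightarrow> int) \<Rightarrow> nat \<Rightarrow> ('i \<Rightarrow> rat) set" where
  "poly_values r k = {\<lambda>i. mpoly_eval Q (\<lambda>j. of_int (r i j)) |Q. mpoly_fin Q \<and> deg_le Q k}"

lemma poly_values_diff_smult:
  assumes "f \<in> poly_values r k" "g \<in> poly_values r k"
  shows "(\<lambda>i. f i - c * g i) \<in> poly_values r k"
proof -
  obtain P Q where P: "f = (\<lambda>i. mpoly_eval P (\<lambda>j. of_int (r i j)))" "mpoly_fin P" "deg_le P k"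
    and Q: "g = (\<lambda>i. mpoly_eval Q (\<lambda>j. of_int (r i j)))" "mpoly_fin Q" "deg_le Q k"
    using assms by (auto simp: poly_values_def)
  have "deg_le (\<lambda>\<alpha>. P \<alpha> - c * Q \<alpha>) k" using P(3) Q(3)
    unfolding deg_le_def by (metis diff_0_right mult_zero_right)
  then show ?thesis
    using mpoly_eval_diff_smult[OF P(2) Q(2), of c] unfolding poly_values_def P(1) Q(1)
    by (intro CollectI exI[of _ "\<lambda>\<alpha>. P \<alpha> - c * Q \<alpha>"]) simp
qed

lemma poly_values_eq_monomial_span: "poly_values r k = add_span (filtered_gens (monomial_at r) k)"
proof
  show "poly_values r k \<subseteq> add_span (filtered_gens (monomial_at r) k)"
  proof
    fix f assume "f \<in> poly_values r k"
    then obtain Q where Q: "f = (\<lambda>i. mpoly_eval Q (\<lambda>j. of_int (r i j)))" "mpoly_fin Q" "deg_le Q k"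
      by (auto simp: poly_values_def)
    have "f = (\<Sum>\<alpha> | Q \<alpha> \<noteq> 0. (\<lambda>i. Q \<alpha> * monomial_at r \<alpha> i))"
    proof
      fix i
      have "(\<Sum>\<alpha>\<in>A. (\<lambda>i. Q \<alpha> * monomial_at r \<alpha> i)) i = (\<Sum>\<alpha>\<in>A. Q \<alpha> * monomial_at r \<alpha> i)" for A
        by (induction A rule: infinite_finite_induct) auto
      then show "f i = (\<Sum>\<alpha> | Q \<alpha> \<noteq> 0. (\<lambda>i. Q \<alpha> * monomial_at r \<alpha> i)) i"
        by (simp add: Q(1) mpoly_eval_def monomial_at_def)
    qed
    also have "\<dots> \<in> add_span (filtered_gens (monomial_at r) k)"
      using Q(3) by (intro add_span_sum add_span_base filtered_gensI) (auto simp: deg_le_def)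
    finally show "f \<in> add_span (filtered_gens (monomial_at r) k)" .
  qed
  have "f \<in> poly_values r k" if "f \<in> add_span (filtered_gens (monomial_at r) k)" for f
    using that
  proof (induction rule: add_span.induct)
    case zero
    show ?case unfolding poly_values_def
      by (intro CollectI exI[of _ "\<lambda>_. 0"]) (auto simp: mpoly_eval_def mpoly_fin_def deg_le_def)
  next
    case (step g h)
    then obtain c \<beta> Q where g: "g = (\<lambda>i. c * monomial_at r \<beta> i)" "sum \<beta> UNIV \<le> k"
      and Q: "h = (\<lambda>i. mpoly_eval Q (\<lambda>j. of_int (r i j)))" "mpoly_fin Q" "deg_le Q k"
      by (auto simp: poly_values_def filtered_gens_def)
    let ?P = "Q(\<beta> := Q \<beta> + c)" and ?A = "insert \<beta> {\<alpha>. Q \<alpha> \<noteq> 0}"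
    have fin: "finite ?A" using Q(2) by (simp add: mpoly_fin_def)
    have sub: "{\<alpha>. ?P \<alpha> \<noteq> 0} \<subseteq> ?A" by auto
    have "mpoly_eval ?P x = c * (\<Prod>j\<in>UNIV. x j ^ \<beta> j) + mpoly_eval Q x" for x
    proof -
      have "mpoly_eval ?P x = (\<Sum>\<alpha>\<in>?A. ?P \<alpha> * (\<Prod>j\<in>UNIV. x j ^ \<alpha> j))"
        by (rule mpoly_eval_superset[OF fin sub])
      also have "\<dots> = (\<Sum>\<alpha>\<in>?A. (if \<alpha> = \<beta> then c * (\<Prod>j\<in>UNIV. x j ^ \<beta> j) else 0) + Q \<alpha> * (\<Prod>j\<in>UNIV. x j ^ \<alpha> j))"
        by (intro sum.cong) (auto simp: algebra_simps)
      also have "\<dots> = c * (\<Prod>j\<in>UNIV. x j ^ \<beta> j) + mpoly_eval Q x"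
        using fin by (subst mpoly_eval_superset[OF fin]) (auto simp: sum.distrib)
      finally show ?thesis .
    qed
    then have "g + h = (\<lambda>i. mpoly_eval ?P (\<lambda>j. of_int (r i j)))"
      by (auto simp: g(1) Q(1) monomial_at_def)
    moreover have "mpoly_fin ?P" using finite_subset[OF sub fin] by (simp add: mpoly_fin_def)
    moreover have "deg_le ?P k" using Q(3) g(2) by (auto simp: deg_le_def)
    ultimately show ?case unfolding poly_values_def by blast
  qed
  then show "add_span (filtered_gens (monomial_at r) k) \<subseteq> poly_values r k" by blast
qed

text \<open>Partial derivatives of the parametrisation produce falling factorials, whereas Euler
  derivatives use arbitrary polynomials. This equality identifies the two families of linear
  conditions.\<close>

lemma poly_values_eq_falling_span: "poly_values r k = add_span (filtered_gens (falling_at r) k)"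
proof -
  have m: "monomial_at r (\<alpha>(j := Suc (\<alpha> j))) i = (of_int (r i j) - 0) * monomial_at r \<alpha> i" for \<alpha> j i
    unfolding monomial_at_def by (simp add: prod.remove[of UNIV j])
  have f: "falling_at r (\<alpha>(j := Suc (\<alpha> j))) i = (of_int (r i j) - of_nat (\<alpha> j)) * falling_at r \<alpha> i" for \<alpha> j i
    unfolding falling_at_def by (simp add: prod.remove[of UNIV j])
  have "monomial_at r (\<lambda>_. 0) i = 1" "falling_at r (\<lambda>_. 0) i = 1" for i
    by (simp_all add: monomial_at_def falling_at_def)
  then show ?thesis unfolding poly_values_eq_monomial_span
    using filtered_gens_change_basis[where g = "monomial_at r" and h = "falling_at r" and s = "\<lambda>_ _. 0", OF _ m _ f]
      filtered_gens_change_basis[where h = "monomial_at r" and g = "falling_at r" and s' = "\<lambda>_ _. 0", OF _ f _ m]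
    by blast
qed

text \<open>The complex solutions of a linear system with rational coefficients, so that solutions
  found over the rationals can be embedded.\<close>

definition osc_kernel :: "('i::finite \<Rightarrow> 'n::finite \<Rightarrow> int) \<Rightarrow> nat \<Rightarrow> ('i \<Rightarrow> complex) set" where
  "osc_kernel r k = {y. \<forall>f\<in>poly_values r k. (\<Sum>i\<in>UNIV. of_rat (f i) * y i) = 0}"

lemma osc_kernel_lin:
  assumes "y \<in> osc_kernel r k" "z \<in> osc_kernel r k"
  shows "(\<lambda>i. y i + c * z i) \<in> osc_kernel r k"
proof -
  have "(\<Sum>i\<in>UNIV. of_rat (f i) * (y i + c * z i))
    = (\<Sum>i\<in>UNIV. of_rat (f i) * y i) + c * (\<Sum>i\<in>UNIV. of_rat (f i) * z i)" for f
    by (simp add: algebra_simps sum.distrib sum_distrib_left)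
  then show ?thesis using assms by (simp add: osc_kernel_def)
qed

lemma osc_kernel_zero: "(\<lambda>_. 0) \<in> osc_kernel r k"
  by (simp add: osc_kernel_def)

lemma osc_kernel_falling_iff:
  "y \<in> osc_kernel r k \<longleftrightarrow>
    (\<forall>\<alpha>. sum \<alpha> UNIV \<le> k \<longrightarrow> (\<Sum>i\<in>UNIV. (\<Prod>j\<in>UNIV. falling_int (r i j) (\<alpha> j)) * y i) = 0)"
proof -
  have fall: "of_rat (falling_at r \<alpha> i) = (\<Prod>j\<in>UNIV. falling_int (r i j) (\<alpha> j))" for \<alpha> i
    by (simp add: falling_at_def falling_int_def of_rat_prod of_rat_diff)
  show ?thesis
  proof (intro iffI allI impI)
    fix \<alpha> :: "'b \<Rightarrow> nat"
    assume y: "y \<in> osc_kernel r k" and "sum \<alpha> UNIV \<le> k"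
    then have "(\<lambda>i. 1 * falling_at r \<alpha> i) \<in> poly_values r k"
      unfolding poly_values_eq_falling_span by (intro add_span_base filtered_gensI)
    with y show "(\<Sum>i\<in>UNIV. (\<Prod>j\<in>UNIV. falling_int (r i j) (\<alpha> j)) * y i) = 0"
      by (auto simp: osc_kernel_def fall dest!: bspec)
  next
    assume *: "\<forall>\<alpha>. sum \<alpha> UNIV \<le> k \<longrightarrow> (\<Sum>i\<in>UNIV. (\<Prod>j\<in>UNIV. falling_int (r i j) (\<alpha> j)) * y i) = 0"
    have "(\<Sum>i\<in>UNIV. of_rat (f i) * y i) = 0" if "f \<in> add_span (filtered_gens (falling_at r) k)" for f
      using that
    proof (induction rule: add_span.induct)
      case (step g h)
      then obtain c \<beta> where g: "g = (\<lambda>i. c * falling_at r \<beta> i)" "sum \<beta> UNIV \<le> k"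
        by (auto simp: filtered_gens_def)
      have "(\<Sum>i\<in>UNIV. of_rat ((g + h) i) * y i)
        = of_rat c * (\<Sum>i\<in>UNIV. of_rat (falling_at r \<beta> i) * y i) + (\<Sum>i\<in>UNIV. of_rat (h i) * y i)"
        by (simp add: g(1) of_rat_add of_rat_mult algebra_simps sum.distrib sum_distrib_left)
      then show ?case using step.IH * g(2) by (simp add: fall)
    qed simp
    then show "y \<in> osc_kernel r k" by (simp add: osc_kernel_def poly_values_eq_falling_span)
  qed
qed

lemma mono_int_add:
  assumes "\<And>j. x j \<noteq> 0"
  shows "mono_int x (\<lambda>j. a j + b j) = mono_int x a * mono_int x b"
  unfolding mono_int_def by (simp add: power_int_add assms prod.distrib)

lemma mono_int_nonzero:
  assumes "\<And>j. x j \<noteq> 0"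
  shows "mono_int x a \<noteq> 0"
  unfolding mono_int_def using assms by simp

text \<open>The entry of \<open>osc_vec\<close> at \<open>i\<close> is a product of falling
  factorials times \<open>mono_int x (r i)\<close> times a nonzero factor common to all
  \<open>i\<close>. Dropping that factor leaves linear conditions on the rescaled vector, with
  coefficients free of \<open>x\<close>.\<close>

lemma osc_hyperplanes_iff:
  "c \<in> osc_hyperplanes r k \<longleftrightarrow>
    c \<noteq> (\<lambda>_. 0) \<and> (\<exists>x. (\<forall>j. x j \<noteq> 0) \<and> (\<lambda>i. c i * mono_int x (r i)) \<in> osc_kernel r k)"
proof -
  have "(\<Sum>i\<in>UNIV. c i * osc_vec r x \<alpha> i) = 0 \<longleftrightarrow>
    (\<Sum>i\<in>UNIV. (\<Prod>j\<in>UNIV. falling_int (r i j) (\<alpha> j)) * (c i * mono_int x (r i))) = 0"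
    if x: "\<forall>j. x j \<noteq> 0" for x \<alpha>
  proof -
    have "(\<Sum>i\<in>UNIV. c i * osc_vec r x \<alpha> i)
      = mono_int x (\<lambda>j. - int (\<alpha> j)) * (\<Sum>i\<in>UNIV. (\<Prod>j\<in>UNIV. falling_int (r i j) (\<alpha> j)) * (c i * mono_int x (r i)))"
      using mono_int_add[of x _ "\<lambda>j. - int (\<alpha> j)"] x
      by (simp add: osc_vec_def sum_distrib_left mult_ac)
    then show ?thesis using mono_int_nonzero[of x] x by simp
  qed
  then show ?thesis
    unfolding osc_hyperplanes_def osc_kernel_falling_iff by (simp cong: conj_cong)
qed

section \<open>From tropical points to the dual cone\<close>

text \<open>Passing to the Zariski closure does not change which polynomials vanish.\<close>

lemma vanishing_ideal_dual_cone:
  "F \<in> vanishing_ideal (dual_cone r k) \<longleftrightarrow> mpoly_fin F \<and> (\<forall>c\<in>osc_hyperplanes r k. mpoly_eval F c = 0)"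
  unfolding vanishing_ideal_def dual_cone_def zariski_closure_def by auto

lemma osc_kernel_sum: "(\<And>i. i \<in> A \<Longrightarrow> y i \<in> osc_kernel r k) \<Longrightarrow> (\<lambda>l. \<Sum>i\<in>A. c i * y i l) \<in> osc_kernel r k"
proof (induction A rule: infinite_finite_induct)
  case (insert a A)
  then have "(\<lambda>l. (\<Sum>i\<in>A. c i * y i l) + c a * y a l) \<in> osc_kernel r k"
    by (intro osc_kernel_lin) auto
  then show ?case using insert.hyps by (simp add: add.commute)
qed (simp_all add: osc_kernel_zero)

text \<open>If \<open>f\<close> in \<open>poly_values r k\<close> is nonzero at \<open>i\<close>,
  the minimum over its support is attained twice, so the support has another index whose term is at
  most that of \<open>i\<close>. This is the hypothesis of \<open>annihilator_exists\<close> for the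
  set \<open>?J\<close> of all such indices.\<close>

lemma tropical_kernel_vector_exists:
  assumes w: "\<And>Q. mpoly_fin Q \<Longrightarrow> deg_le Q k \<Longrightarrow> w \<in> euler_V r u Q"
  shows "\<exists>d\<in>osc_kernel r k. d i \<noteq> 0 \<and> (\<forall>l. trop_term r u i w < trop_term r u l w \<longrightarrow> d l = 0)"
proof -
  let ?v = "\<lambda>l. trop_term r u l w" and ?J = "{l. l \<noteq> i \<and> trop_term r u l w \<le> trop_term r u i w}"
  have supp: "\<exists>j\<in>?J. f j \<noteq> 0" if "f \<in> poly_values r k" "f i \<noteq> 0" for f
  proof -
    obtain Q where Q: "f = (\<lambda>i. mpoly_eval Q (\<lambda>j. of_int (r i j)))" "mpoly_fin Q" "deg_le Q k"
      using \<open>f \<in> poly_values r k\<close> by (auto simp: poly_values_def)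
    have "w \<in> trop_V {l. f l \<noteq> 0} (trop_term r u)"
      using w[OF Q(2,3)] unfolding euler_V_def Q(1) .
    then obtain i1 i2 where "f i1 \<noteq> 0" "f i2 \<noteq> 0" "i1 \<noteq> i2" "?v i1 = ?v i2" "?v i1 \<le> ?v i"
      using \<open>f i \<noteq> 0\<close> unfolding trop_V_def by auto
    then show ?thesis by (cases "i1 = i") auto
  qed
  have "\<exists>d. d i = 1 \<and> (\<forall>l. l \<notin> insert i ?J \<longrightarrow> d l = 0) \<and> (\<forall>f\<in>poly_values r k. (\<Sum>l\<in>insert i ?J. d l * f l) = 0)"
    by (rule annihilator_exists) (use supp in \<open>simp_all add: poly_values_diff_smult\<close>)
  then obtain d where d: "d i = 1" "\<And>l. l \<notin> insert i ?J \<Longrightarrow> d l = 0"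
    "\<And>f. f \<in> poly_values r k \<Longrightarrow> (\<Sum>l\<in>insert i ?J. d l * f l) = 0"
    by blast
  have "(\<Sum>l\<in>UNIV. of_rat (f l) * of_rat (d l)) = (0 :: complex)" if "f \<in> poly_values r k" for f
  proof -
    have "(\<Sum>l\<in>UNIV. d l * f l) = (\<Sum>l\<in>insert i ?J. d l * f l)"
      by (rule sum.mono_neutral_right) (use d(2) in auto)
    also have "\<dots> = 0" by (rule d(3)[OF that])
    finally have "of_rat (\<Sum>l\<in>UNIV. d l * f l) = (0 :: complex)" by simp
    then show ?thesis by (simp add: of_rat_sum of_rat_mult mult.commute)
  qed
  then have "(\<lambda>l. of_rat (d l)) \<in> osc_kernel r k" by (simp add: osc_kernel_def)
  moreover have "d l = 0" if "?v i < ?v l" for l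
    using d(2)[of l] that by auto
  ultimately show ?thesis using d(1) by (intro bexI[of _ "\<lambda>l. of_rat (d l)"]) auto
qed

lemma mono_int_powr:
  assumes "0 < t"
  shows "mono_int (\<lambda>j. of_real (t powr w j)) e = of_real (t powr (\<Sum>j\<in>UNIV. w j * of_int (e j)))"
proof -
  have "(t powr w j) powi e j = t powr (w j * of_int (e j))" for j
    using assms powr_real_of_int'[of "t powr w j" "e j"] by (simp add: powr_powr)
  then show ?thesis
    using assms by (simp add: mono_int_def powr_sum del: of_real_power_int flip: of_real_power_int)
qed

text \<open>A curve of osculating hyperplanes is built whose coordinate \<open>l\<close> has exact
  order \<open>u l\<close> in \<open>t\<close>; along it no polynomial with monomial initial form
  can vanish.\<close>

lemma trop_if_tropical_point:
  fixes r :: "'i::finite \<Rightarrow> 'n::finite \<Rightarrow> int"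
  assumes w: "\<And>Q. mpoly_fin Q \<Longrightarrow> deg_le Q k \<Longrightarrow> w \<in> euler_V r u Q"
  shows "u \<in> trop (dual_cone r k)"
proof -
  define v where "v l = trop_term r u l w" for l
  \<comment> \<open>For each level \<mu>, a generic kernel vector supported where \<open>v\<close>
    is at most \<mu>; genericity makes all coordinates of level \<mu> nonzero at once.\<close>
  have "\<exists>d\<in>osc_kernel r k. (\<forall>l. \<mu> < v l \<longrightarrow> d l = 0) \<and> (\<forall>l. v l = \<mu> \<longrightarrow> d l \<noteq> 0)" for \<mu>
  proof -
    let ?L = "{d \<in> osc_kernel r k. \<forall>l. \<mu> < v l \<longrightarrow> d l = 0}"
    have "\<exists>d\<in>?L. \<forall>j\<in>{l. v l = \<mu>}. d j \<noteq> 0"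
    proof (rule generic_vector_exists)
      show "?L \<noteq> {}" using osc_kernel_zero by blast
      show "(\<lambda>l. f l + c * g l) \<in> ?L" if "f \<in> ?L" "g \<in> ?L" for f g c
        using that osc_kernel_lin by auto
      show "\<exists>d\<in>?L. d j \<noteq> 0" if "j \<in> {l. v l = \<mu>}" for j
        using tropical_kernel_vector_exists[OF w, where i = j] that unfolding v_def by auto
    qed simp
    then show ?thesis by blast
  qed
  then obtain D where D: "\<And>\<mu>. D \<mu> \<in> osc_kernel r k" "\<And>\<mu> l. \<mu> < v l \<Longrightarrow> D \<mu> l = 0" "\<And>l. D (v l) l \<noteq> 0"
    by metis
  \<comment> \<open>In coordinate \<open>l\<close> the summands with \<mu> below \<open>v l\<close>
    vanish, so the leading term is \<open>D (v l) l\<close> times \<open>t powr v l\<close>.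
    Dividing by the monomial in \<open>x t\<close>, which is a power of \<open>t\<close>, leaves
    order \<open>u l\<close>.\<close>
  define d where "d t l = (\<Sum>\<mu>\<in>range v. of_real (t powr \<mu>) * D \<mu> l)" for t l
  define x :: "real \<Rightarrow> 'n \<Rightarrow> complex" where "x t = (\<lambda>j. of_real (t powr w j))" for t
  define c where "c t l = d t l / mono_int (x t) (r l)" for t l
  have x: "x t j \<noteq> 0" if "0 < t" for t j using that by (simp add: x_def)
  have lim: "((\<lambda>t. c t l / of_real (t powr u l)) \<longlongrightarrow> D (v l) l) (at_right 0)" for l
  proof -
    have eq: "c t l / of_real (t powr u l) = (\<Sum>\<mu>\<in>range v. of_real (t powr (\<mu> - v l)) * D \<mu> l)" if "0 < t" for t
    proof -
      have "of_real (t powr u l) * mono_int (x t) (r l) = of_real (t powr v l)"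
        using that by (simp add: x_def mono_int_powr v_def trop_term_def powr_add)
      then have "c t l / of_real (t powr u l) = d t l / of_real (t powr v l)"
        by (simp add: c_def divide_divide_eq_left mult.commute)
      then show ?thesis by (simp add: d_def sum_divide_distrib powr_diff)
    qed
    have "((\<lambda>t. \<Sum>\<mu>\<in>range v. of_real (t powr (\<mu> - v l)) * D \<mu> l) \<longlongrightarrow>
      (\<Sum>\<mu>\<in>range v. if \<mu> = v l then D \<mu> l else 0)) (at_right 0)"
    proof (rule tendsto_sum)
      fix \<mu>
      show "((\<lambda>t. of_real (t powr (\<mu> - v l)) * D \<mu> l) \<longlongrightarrow> (if \<mu> = v l then D \<mu> l else 0)) (at_right 0)"
      proof (cases \<mu> "v l" rule: linorder_cases)
        case less
        then show ?thesis using D(2) by simp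
      next
        case equal
        have "\<forall>\<^sub>F t in at_right (0::real). D \<mu> l = of_real (t powr (\<mu> - v l)) * D \<mu> l"
          using eventually_at_right_less[of 0] by eventually_elim (simp add: equal)
        then show ?thesis unfolding if_P[OF equal] by (rule Lim_transform_eventually[OF tendsto_const])
      next
        case greater
        then show ?thesis using tendsto_mult[OF tendsto_powr_at_right_0 tendsto_const, of "\<mu> - v l" "D \<mu> l"] by simp
      qed
    qed
    moreover have "\<forall>\<^sub>F t in at_right 0. (\<Sum>\<mu>\<in>range v. of_real (t powr (\<mu> - v l)) * D \<mu> l) = c t l / of_real (t powr u l)"
      using eventually_at_right_less[of 0] by eventually_elim (simp add: eq)
    ultimately show ?thesis using Lim_transform_eventually by fastforce
  qed
  \<comment> \<open>\<open>undefined\<close> serves as an arbitrary fixed coordinate. That it is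
    nonzero keeps \<open>c t\<close> from being the zero vector, and this holds for all small
    \<open>t\<close> because the limit is nonzero.\<close>
  have osc: "c t \<in> osc_hyperplanes r k" if "0 < t" "c t undefined \<noteq> 0" for t
  proof -
    have "(\<lambda>l. c t l * mono_int (x t) (r l)) = d t"
      using mono_int_nonzero[of "x t"] x[OF that(1)] by (simp add: c_def)
    moreover have "d t \<in> osc_kernel r k"
      unfolding d_def by (intro osc_kernel_sum D(1))
    moreover have "c t \<noteq> (\<lambda>_. 0)" using that(2) by metis
    ultimately show ?thesis
      using x[OF that(1)] unfolding osc_hyperplanes_iff by (intro conjI exI[of _ "x t"]) simp_all
  qed
  show ?thesis unfolding trop_def
  proof (intro CollectI ballI impI)
    fix F assume "F \<in> vanishing_ideal (dual_cone r k)"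
    then have F: "mpoly_fin F" "\<And>c. c \<in> osc_hyperplanes r k \<Longrightarrow> mpoly_eval F c = 0"
      by (simp_all add: vanishing_ideal_dual_cone)
    show "\<not> initial_is_monomial u F"
    proof (rule curve_excludes_monomial_initial_form[OF lim D(3) F(1)])
      show "\<forall>\<^sub>F t in at_right 0. mpoly_eval F (c t) = 0"
        using eventually_at_right_less[of 0] tendsto_imp_eventually_ne[OF lim D(3), of undefined]
      proof eventually_elim
        case (elim t)
        then show ?case using F(2)[OF osc] by auto
      qed
    qed
  qed
qed

section \<open>From the dual cone to tropical points\<close>

text \<open>If the kernel vanished in coordinate \<open>i\<close>, the single variable with index
  \<open>i\<close> would vanish on the dual cone. The vanishing ideal would then contain a monomial
  and the tropicalization would be empty.\<close>

lemma osc_kernel_coordinate_nonzero: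
  fixes r :: "'i::finite \<Rightarrow> 'n::finite \<Rightarrow> int"
  assumes "u \<in> trop (dual_cone r k)"
  shows "\<exists>d\<in>osc_kernel r k. d i \<noteq> 0"
proof (rule ccontr)
  assume "\<not> ?thesis"
  then have no: "d i = 0" if "d \<in> osc_kernel r k" for d using that by blast
  define \<delta> :: "'i \<Rightarrow> nat" where "\<delta> = (\<lambda>l. if l = i then 1 else 0)"
  define F :: "('i \<Rightarrow> nat) \<Rightarrow> complex" where "F = (\<lambda>\<alpha>. if \<alpha> = \<delta> then 1 else 0)"
  have supp: "{\<alpha>. F \<alpha> \<noteq> 0} = {\<delta>}" by (auto simp: F_def)
  have "mpoly_eval F c = (\<Prod>v\<in>UNIV. if v = i then c i else 1)" for c
    unfolding mpoly_eval_def supp by (simp add: F_def \<delta>_def if_distrib[of "\<lambda>n. _ ^ n"] cong: if_cong prod.cong)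
  then have ev: "mpoly_eval F c = c i" for c by simp
  have "c i = 0" if "c \<in> osc_hyperplanes r k" for c
  proof -
    obtain x where x: "\<forall>j. x j \<noteq> 0" and d: "(\<lambda>i. c i * mono_int x (r i)) \<in> osc_kernel r k"
      using \<open>c \<in> osc_hyperplanes r k\<close> unfolding osc_hyperplanes_iff by blast
    from no[OF d] show ?thesis using mono_int_nonzero[of x] x by simp
  qed
  then have "F \<in> vanishing_ideal (dual_cone r k)"
    by (simp add: vanishing_ideal_dual_cone ev mpoly_fin_def supp)
  moreover have "F \<noteq> (\<lambda>_. 0)" using supp by auto
  moreover have "initial_is_monomial u F"
    unfolding initial_is_monomial_def by (intro exI[of _ \<delta>]) (auto simp: F_def)
  ultimately show False using assms by (auto simp: trop_def)
qed

lemma mpoly_eval_tendsto: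
  fixes F :: "('i::finite \<Rightarrow> nat) \<Rightarrow> complex"
  assumes "\<And>i. ((\<lambda>t. c t i) \<longlongrightarrow> C i) G"
  shows "((\<lambda>t. mpoly_eval F (c t)) \<longlongrightarrow> mpoly_eval F C) G"
  unfolding mpoly_eval_def by (intro tendsto_intros assms)

text \<open>Laurent monomials can only be tested at vectors without zero coordinates. Moving in the
  direction \<open>e\<close> makes all coordinates nonzero for small \<open>s\<close> other than 0,
  and continuity at \<open>s = 0\<close> gives the rest.\<close>

lemma mpoly_eval_zero_on_osc_hyperplanes:
  fixes r :: "'i::finite \<Rightarrow> 'n::finite \<Rightarrow> int"
  assumes e: "e \<in> osc_kernel r k" "\<And>i. e i \<noteq> 0"
    and F: "\<And>d x. d \<in> osc_kernel r k \<Longrightarrow> \<forall>i. d i \<noteq> 0 \<Longrightarrow> \<forall>j. x j \<noteq> 0 \<Longrightarrow>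
      mpoly_eval F (\<lambda>i. d i / mono_int x (r i)) = 0"
    and c: "c \<in> osc_hyperplanes r k"
  shows "mpoly_eval F c = 0"
proof -
  obtain x where x: "\<forall>j. x j \<noteq> 0" and d: "(\<lambda>i. c i * mono_int x (r i)) \<in> osc_kernel r k"
    using c unfolding osc_hyperplanes_iff by blast
  define d' where "d' s i = c i * mono_int x (r i) + s * e i" for s i
  have lim: "((\<lambda>s. d' s i) \<longlongrightarrow> c i * mono_int x (r i) + 0 * e i) (at 0)" for i
    unfolding d'_def by (intro tendsto_intros)
  have ne: "\<forall>\<^sub>F s in at 0. d' s i \<noteq> 0" for i
  proof (cases "c i = 0")
    case True
    have "\<forall>\<^sub>F s in at (0::complex). s \<noteq> 0" by (simp add: eventually_at_filter)
    then show ?thesis by eventually_elim (simp add: d'_def True e(2))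
  next
    case False
    then show ?thesis using lim[of i] mono_int_nonzero[of x] x
      by (intro tendsto_imp_eventually_ne[OF lim]) simp
  qed
  have "\<forall>\<^sub>F s in at 0. mpoly_eval F (\<lambda>i. d' s i / mono_int x (r i)) = 0"
  proof -
    have "\<forall>\<^sub>F s in at 0. \<forall>i\<in>UNIV. d' s i \<noteq> 0" by (rule eventually_ball_finite) (simp_all add: ne)
    then show ?thesis
    proof eventually_elim
      case (elim s)
      have "d' s \<in> osc_kernel r k" unfolding d'_def by (rule osc_kernel_lin[OF d e(1)])
      then show ?case using F[of "d' s" x] elim x by simp
    qed
  qed
  moreover have "((\<lambda>s. mpoly_eval F (\<lambda>i. d' s i / mono_int x (r i))) \<longlongrightarrow> mpoly_eval F c) (at 0)"
  proof (rule mpoly_eval_tendsto)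
    fix i
    have "((\<lambda>s. d' s i / mono_int x (r i)) \<longlongrightarrow> (c i * mono_int x (r i) + 0 * e i) / mono_int x (r i)) (at 0)"
      using mono_int_nonzero[of x] x by (intro tendsto_divide lim tendsto_const) simp
    then show "((\<lambda>s. d' s i / mono_int x (r i)) \<longlongrightarrow> c i) (at 0)"
      using mono_int_nonzero[of x] x by simp
  qed
  ultimately have "((\<lambda>s. 0) \<longlongrightarrow> mpoly_eval F c) (at (0::complex))"
    using Lim_transform_eventually by fastforce
  then show ?thesis by (simp add: tendsto_const_iff)
qed

text \<open>Clearing denominators in a relation \<open>1 = (terms of positive weight)\<close> gives an element
  of the ideal whose initial form is a monomial.\<close>
lemma trop_no_positive_relation:
  fixes r :: "'i::finite \<Rightarrow> 'n::finite \<Rightarrow> int" and \<alpha> :: "'s \<Rightarrow> 'i \<Rightarrow> int"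
  assumes u: "u \<in> trop (dual_cone r k)"
    and e: "e \<in> osc_kernel r k" "\<And>i. e i \<noteq> 0"
    and A: "finite A" "\<And>s. s \<in> A \<Longrightarrow> 0 < (\<Sum>i\<in>UNIV. real_of_int (\<alpha> s i) * u i)"
    and rel: "\<And>d x. d \<in> osc_kernel r k \<Longrightarrow> \<forall>i. d i \<noteq> 0 \<Longrightarrow> \<forall>j. x j \<noteq> 0 \<Longrightarrow>
      (\<Sum>s\<in>A. z s * mono_int (\<lambda>i. d i / mono_int x (r i)) (\<alpha> s)) = 1"
  shows False
proof -
  \<comment> \<open>Large enough that adding any exponent \<open>\<alpha> s\<close> leaves a vector
    of natural numbers, namely \<open>h s\<close>.\<close>
  define \<beta> :: "'i \<Rightarrow> nat" where "\<beta> i = (\<Sum>s\<in>A. nat \<bar>\<alpha> s i\<bar>)" for i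
  define h :: "'s \<Rightarrow> 'i \<Rightarrow> nat" where "h s i = nat (int (\<beta> i) + \<alpha> s i)" for s i
  have h: "int (h s i) = int (\<beta> i) + \<alpha> s i" if "s \<in> A" for s i
  proof -
    have "nat \<bar>\<alpha> s i\<bar> \<le> \<beta> i" unfolding \<beta>_def using A(1) that by (intro member_le_sum) auto
    then show ?thesis unfolding h_def by linarith
  qed
  \<comment> \<open>The relation \<open>1 = (sum)\<close> multiplied by the monomial with exponent
    \<beta>. Indices with the same \<open>h s\<close> have their coefficients added.\<close>
  define F :: "('i \<Rightarrow> nat) \<Rightarrow> complex" where
    "F \<epsilon> = (if \<epsilon> = \<beta> then 1 else 0) - (\<Sum>s\<in>A. if \<epsilon> = h s then z s else 0)" for \<epsilon>
  let ?T = "insert \<beta> (h ` A)"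
  have supp: "{\<epsilon>. F \<epsilon> \<noteq> 0} \<subseteq> ?T"
  proof
    fix \<epsilon> assume "\<epsilon> \<in> {\<epsilon>. F \<epsilon> \<noteq> 0}"
    moreover have "F \<epsilon> = 0" if "\<epsilon> \<notin> ?T"
    proof -
      have "(\<Sum>s\<in>A. if \<epsilon> = h s then z s else 0) = 0" using that by (intro sum.neutral) auto
      then show ?thesis using that by (simp add: F_def)
    qed
    ultimately show "\<epsilon> \<in> ?T" by blast
  qed
  have fin: "finite ?T" using A(1) by simp
  have ev: "mpoly_eval F c = (\<Prod>v\<in>UNIV. c v ^ \<beta> v) - (\<Sum>s\<in>A. z s * (\<Prod>v\<in>UNIV. c v ^ h s v))" for c
  proof -
    let ?m = "\<lambda>\<epsilon>. \<Prod>v\<in>UNIV. c v ^ \<epsilon> v"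
    have "mpoly_eval F c = (\<Sum>\<epsilon>\<in>?T. F \<epsilon> * ?m \<epsilon>)" by (rule mpoly_eval_superset[OF fin supp])
    also have "\<dots> = (\<Sum>\<epsilon>\<in>?T. (if \<epsilon> = \<beta> then ?m \<beta> else 0) - (\<Sum>s\<in>A. if \<epsilon> = h s then z s * ?m (h s) else 0))"
      unfolding F_def left_diff_distrib sum_distrib_right
      by (intro sum.cong arg_cong2[where f = "(-)"]) auto
    also have "\<dots> = ?m \<beta> - (\<Sum>s\<in>A. \<Sum>\<epsilon>\<in>?T. if \<epsilon> = h s then z s * ?m (h s) else 0)"
      unfolding sum_subtractf using fin by (subst (2) sum.swap) simp
    also have "(\<Sum>s\<in>A. \<Sum>\<epsilon>\<in>?T. if \<epsilon> = h s then z s * ?m (h s) else 0) = (\<Sum>s\<in>A. z s * ?m (h s))"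
      using fin by (intro sum.cong refl) simp
    finally show ?thesis .
  qed
  have "mpoly_eval F (\<lambda>i. d i / mono_int x (r i)) = 0"
    if "d \<in> osc_kernel r k" and d: "\<forall>i. d i \<noteq> 0" and x: "\<forall>j. x j \<noteq> 0" for d x
  proof -
    let ?c = "\<lambda>i. d i / mono_int x (r i)"
    have c: "?c v \<noteq> 0" for v using d x mono_int_nonzero[of x] by simp
    have "(\<Prod>v\<in>UNIV. ?c v ^ h s v) = (\<Prod>v\<in>UNIV. ?c v ^ \<beta> v) * mono_int ?c (\<alpha> s)" if "s \<in> A" for s
    proof -
      have "?c v ^ h s v = ?c v ^ \<beta> v * ?c v powi \<alpha> s v" for v
        using power_int_add[of "?c v" "int (\<beta> v)" "\<alpha> s v"] c[of v] h[OF that, of v]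
        by (simp flip: power_int_of_nat)
      then show ?thesis by (simp only: mono_int_def prod.distrib)
    qed
    then have "(\<Sum>s\<in>A. z s * (\<Prod>v\<in>UNIV. ?c v ^ h s v))
      = (\<Prod>v\<in>UNIV. ?c v ^ \<beta> v) * (\<Sum>s\<in>A. z s * mono_int ?c (\<alpha> s))"
      by (simp add: sum_distrib_left mult.left_commute del: power_divide)
    then show ?thesis using rel[OF that] by (simp add: ev del: power_divide)
  qed
  then have "\<And>c. c \<in> osc_hyperplanes r k \<Longrightarrow> mpoly_eval F c = 0"
    by (rule mpoly_eval_zero_on_osc_hyperplanes[OF e])
  then have "F \<in> vanishing_ideal (dual_cone r k)"
    using finite_subset[OF supp fin] by (simp add: vanishing_ideal_dual_cone mpoly_fin_def)
  moreover have wt: "(\<Sum>v\<in>UNIV. real (\<beta> v) * u v) < (\<Sum>v\<in>UNIV. real (h s v) * u v)" if "s \<in> A" for s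
  proof -
    have "real (h s v) = real (\<beta> v) + real_of_int (\<alpha> s v)" for v
      using h[OF that, of v] by linarith
    then show ?thesis using A(2)[OF that] by (simp add: algebra_simps sum.distrib)
  qed
  then have "h s \<noteq> \<beta>" if "s \<in> A" for s using that by fastforce
  then have "(\<Sum>s\<in>A. if \<beta> = h s then z s else 0) = 0" by (intro sum.neutral) auto
  then have F1: "F \<beta> = 1" by (simp add: F_def)
  have "initial_is_monomial u F"
    unfolding initial_is_monomial_def
  proof (intro exI[of _ \<beta>] conjI allI impI)
    fix \<epsilon> assume "F \<epsilon> \<noteq> 0 \<and> \<epsilon> \<noteq> \<beta>"
    then obtain s where "s \<in> A" "\<epsilon> = h s" using supp by auto
    then show "(\<Sum>v\<in>UNIV. real (\<beta> v) * u v) < (\<Sum>v\<in>UNIV. real (\<epsilon> v) * u v)" using wt by simp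
  qed (simp add: F1)
  moreover have "F \<noteq> (\<lambda>_. 0)" using F1 by (metis zero_neq_one)
  ultimately show False using u by (auto simp: trop_def)
qed

section \<open>The weight filtration on a ring of functions of \<open>(d, x, t)\<close>\<close>

lemma add_span_mult:
  fixes f g :: "'a::comm_semiring_0"
  assumes "\<And>g h. g \<in> G \<Longrightarrow> h \<in> H \<Longrightarrow> g * h \<in> K" "f \<in> add_span G" "g \<in> add_span H"
  shows "f * g \<in> add_span K"
proof (rule add_span_image[OF assms(2), where \<phi> = "\<lambda>f. f * g"])
  fix f assume "f \<in> G"
  then show "f * g \<in> add_span K"
    using assms(1) by (intro add_span_image[OF assms(3), where \<phi> = "\<lambda>g. f * g"])
      (auto simp: distrib_left intro: add_span_base)
qed (auto simp: distrib_right)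

lemma add_span_diff:
  fixes f g :: "'a::ab_group_add"
  assumes "\<And>g. g \<in> G \<Longrightarrow> - g \<in> G" "f \<in> add_span G" "g \<in> add_span G"
  shows "f - g \<in> add_span G"
proof -
  have "- g \<in> add_span G"
    using assms(1) by (intro add_span_image[OF assms(3), where \<phi> = uminus]) (auto intro: add_span_base)
  from add_span_add[OF assms(2) this] show ?thesis by simp
qed

text \<open>The monomials are functions on a parameter type, with \<rho> supplying the point
  \<open>(d, x, t)\<close>. This places them in the pointwise ring of functions, where they are
  units if all values of \<rho> lie in the torus.\<close>

definition mixed_monomial ::
    "('p \<Rightarrow> ('i::finite \<Rightarrow> complex) \<times> ('n::finite \<Rightarrow> complex) \<times> real) \<Rightarrow> ('i \<Rightarrow> int) \<Rightarrow> ('n \<Rightarrow> int) \<Rightarrow> real \<Rightarrow> 'p \<Rightarrow> complex" where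
  "mixed_monomial \<rho> a b \<gamma> p =
     mono_int (fst (\<rho> p)) a * mono_int (fst (snd (\<rho> p))) b * of_real (snd (snd (\<rho> p)) powr \<gamma>)"

definition torus_valued :: "('p \<Rightarrow> ('i \<Rightarrow> complex) \<times> ('n \<Rightarrow> complex) \<times> real) \<Rightarrow> bool" where
  "torus_valued \<rho> \<longleftrightarrow> (\<forall>p. (\<forall>i. fst (\<rho> p) i \<noteq> 0) \<and> (\<forall>j. fst (snd (\<rho> p)) j \<noteq> 0) \<and> 0 < snd (snd (\<rho> p)))"

lemma mixed_monomial_mult:
  assumes "torus_valued \<rho>"
  shows "mixed_monomial \<rho> a b \<gamma> * mixed_monomial \<rho> a' b' \<gamma>' =
    mixed_monomial \<rho> (\<lambda>i. a i + a' i) (\<lambda>j. b j + b' j) (\<gamma> + \<gamma>')"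
  using assms by (auto simp: mixed_monomial_def torus_valued_def mono_int_add powr_add)

lemma mixed_monomial_one: "torus_valued \<rho> \<Longrightarrow> mixed_monomial \<rho> (\<lambda>_. 0) (\<lambda>_. 0) 0 = 1"
  by (auto simp: mixed_monomial_def torus_valued_def mono_int_def fun_eq_iff)
     (metis less_irrefl)

text \<open>The Laurent monomial \<open>c\<^sup>\<alpha> t\<^sup>\<gamma>\<close> in the coordinates \<open>c\<^sub>i = d\<^sub>i x^(-r\<^sub>i)\<close>. In the valuation to
  be constructed, \<open>c\<^sub>i\<close> has value \<open>u\<^sub>i\<close> and \<open>t\<close> has value 1.\<close>
definition cone_monomial where
  "cone_monomial \<rho> r z \<alpha> \<gamma> = (\<lambda>p. z * mixed_monomial \<rho> \<alpha> (\<lambda>j. - (\<Sum>i\<in>UNIV. \<alpha> i * r i j)) \<gamma> p)"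

definition weight_ge_gens where
  "weight_ge_gens \<rho> r u = {cone_monomial \<rho> r z \<alpha> \<gamma> |z \<alpha> \<gamma>. 0 \<le> \<gamma> + (\<Sum>i\<in>UNIV. real_of_int (\<alpha> i) * u i)}"

definition weight_gt_gens where
  "weight_gt_gens \<rho> r u = {cone_monomial \<rho> r z \<alpha> \<gamma> |z \<alpha> \<gamma>. 0 < \<gamma> + (\<Sum>i\<in>UNIV. real_of_int (\<alpha> i) * u i)}"

lemma weight_gensI:
  "0 \<le> \<gamma> + (\<Sum>i\<in>UNIV. real_of_int (\<alpha> i) * u i) \<Longrightarrow> cone_monomial \<rho> r z \<alpha> \<gamma> \<in> weight_ge_gens \<rho> r u"
  "0 < \<gamma> + (\<Sum>i\<in>UNIV. real_of_int (\<alpha> i) * u i) \<Longrightarrow> cone_monomial \<rho> r z \<alpha> \<gamma> \<in> weight_gt_gens \<rho> r u"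
  by (auto simp: weight_ge_gens_def weight_gt_gens_def)

lemma cone_monomial_mult:
  assumes "torus_valued \<rho>"
  shows "cone_monomial \<rho> r z \<alpha> \<gamma> * cone_monomial \<rho> r z' \<alpha>' \<gamma>' =
    cone_monomial \<rho> r (z * z') (\<lambda>i. \<alpha> i + \<alpha>' i) (\<gamma> + \<gamma>')"
proof -
  have "(\<lambda>j. - (\<Sum>i\<in>UNIV. (\<alpha> i + \<alpha>' i) * r i j))
    = (\<lambda>j. - (\<Sum>i\<in>UNIV. \<alpha> i * r i j) + - (\<Sum>i\<in>UNIV. \<alpha>' i * r i j))"
    by (simp add: distrib_right sum.distrib)
  then show ?thesis
    by (simp only: cone_monomial_def flip: mixed_monomial_mult[OF assms]) (auto simp: mult_ac)
qed

lemma cone_monomial_uminus: "- cone_monomial \<rho> r z \<alpha> \<gamma> = cone_monomial \<rho> r (- z) \<alpha> \<gamma>"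
  by (auto simp: cone_monomial_def)

lemma cone_monomial_const: "torus_valued \<rho> \<Longrightarrow> cone_monomial \<rho> r z (\<lambda>_. 0) 0 = (\<lambda>_. z)"
  using mixed_monomial_one[of \<rho>] by (auto simp: cone_monomial_def fun_eq_iff)

lemma weight_gens_mult:
  assumes "torus_valued \<rho>" "g \<in> weight_ge_gens \<rho> r u"
  shows "h \<in> weight_ge_gens \<rho> r u \<Longrightarrow> g * h \<in> weight_ge_gens \<rho> r u"
    and "h \<in> weight_gt_gens \<rho> r u \<Longrightarrow> g * h \<in> weight_gt_gens \<rho> r u"
proof -
  obtain z \<alpha> \<gamma> where g: "g = cone_monomial \<rho> r z \<alpha> \<gamma>" "0 \<le> \<gamma> + (\<Sum>i\<in>UNIV. real_of_int (\<alpha> i) * u i)"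
    using assms(2) by (auto simp: weight_ge_gens_def)
  show "g * h \<in> weight_ge_gens \<rho> r u" if h: "h \<in> weight_ge_gens \<rho> r u"
  proof -
    obtain z' \<alpha>' \<gamma>' where h: "h = cone_monomial \<rho> r z' \<alpha>' \<gamma>'" "0 \<le> \<gamma>' + (\<Sum>i\<in>UNIV. real_of_int (\<alpha>' i) * u i)"
      using h by (auto simp: weight_ge_gens_def)
    have "0 \<le> \<gamma> + \<gamma>' + (\<Sum>i\<in>UNIV. real_of_int (\<alpha> i + \<alpha>' i) * u i)"
      using g(2) h(2) by (simp add: distrib_right sum.distrib)
    then show ?thesis unfolding g(1) h(1) cone_monomial_mult[OF assms(1)] weight_ge_gens_def by blast
  qed
  show "g * h \<in> weight_gt_gens \<rho> r u" if h: "h \<in> weight_gt_gens \<rho> r u"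
  proof -
    obtain z' \<alpha>' \<gamma>' where h: "h = cone_monomial \<rho> r z' \<alpha>' \<gamma>'" "0 < \<gamma>' + (\<Sum>i\<in>UNIV. real_of_int (\<alpha>' i) * u i)"
      using h by (auto simp: weight_gt_gens_def)
    have "0 < \<gamma> + \<gamma>' + (\<Sum>i\<in>UNIV. real_of_int (\<alpha> i + \<alpha>' i) * u i)"
      using g(2) h(2) by (simp add: distrib_right sum.distrib)
    then show ?thesis unfolding g(1) h(1) cone_monomial_mult[OF assms(1)] weight_gt_gens_def by blast
  qed
qed

lemma weight_gt_span_expansion:
  assumes "h \<in> add_span (weight_gt_gens \<rho> r u)"
  shows "\<exists>(n::nat) z \<alpha> \<gamma>. (\<forall>s<n. 0 < \<gamma> s + (\<Sum>i\<in>UNIV. real_of_int (\<alpha> s i) * u i)) \<and>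
    h = (\<lambda>p. \<Sum>s<n. cone_monomial \<rho> r (z s) (\<alpha> s) (\<gamma> s) p)"
  using assms
proof (induction rule: add_span.induct)
  case zero
  show ?case by (intro exI[of _ 0]) auto
next
  case (step g h)
  then obtain n :: nat and z \<alpha> \<gamma> where n: "\<And>s. s < n \<Longrightarrow> 0 < \<gamma> s + (\<Sum>i\<in>UNIV. real_of_int (\<alpha> s i) * u i)"
    and h: "h = (\<lambda>p. \<Sum>s<n. cone_monomial \<rho> r (z s) (\<alpha> s) (\<gamma> s) p)" by blast
  from step obtain z' \<alpha>' \<gamma>' where g: "g = cone_monomial \<rho> r z' \<alpha>' \<gamma>'" "0 < \<gamma>' + (\<Sum>i\<in>UNIV. real_of_int (\<alpha>' i) * u i)"
    by (auto simp: weight_gt_gens_def)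
  have "g + h = (\<lambda>p. \<Sum>s<Suc n. cone_monomial \<rho> r ((z(n := z')) s) ((\<alpha>(n := \<alpha>')) s) ((\<gamma>(n := \<gamma>')) s) p)"
    by (auto simp: g(1) h)
  moreover have "\<forall>s<Suc n. 0 < (\<gamma>(n := \<gamma>')) s + (\<Sum>i\<in>UNIV. real_of_int ((\<alpha>(n := \<alpha>')) s i) * u i)"
    using n g(2) by (auto simp: less_Suc_eq)
  ultimately show ?case by blast
qed

lemma mono_int_prod_powi:
  fixes x :: "'n::finite \<Rightarrow> complex"
  assumes "\<And>j. x j \<noteq> 0"
  shows "mono_int x (\<lambda>j. \<Sum>i\<in>A. a i * r i j) = (\<Prod>i\<in>A. mono_int x (r i) powi a i)"
proof (induction A rule: infinite_finite_induct)
  case (insert i A)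
  have "(\<Prod>j\<in>B. f j) powi m = (\<Prod>j\<in>B. f j powi m)" for f :: "'n \<Rightarrow> complex" and B m
    by (induction B rule: infinite_finite_induct) (auto simp: power_int_mult_distrib)
  then have "mono_int x (\<lambda>j. a i * r i j) = mono_int x (r i) powi a i"
    by (simp add: mono_int_def mult.commute[of "a i"] power_int_mult)
  then show ?case using insert assms by (simp add: mono_int_add)
qed (simp_all add: mono_int_def)

text \<open>This explains the exponent of \<open>x\<close> in \<open>cone_monomial\<close>.\<close>

lemma mono_int_divide:
  assumes "\<And>j. x j \<noteq> 0"
  shows "mono_int (\<lambda>i. d i / mono_int x (r i)) \<alpha>
    = mono_int d \<alpha> * mono_int x (\<lambda>j. - (\<Sum>i\<in>UNIV. \<alpha> i * r i j))"
proof -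
  have "mono_int x (\<lambda>j. - (\<Sum>i\<in>UNIV. \<alpha> i * r i j)) = (\<Prod>i\<in>UNIV. mono_int x (r i) powi (- \<alpha> i))"
    using mono_int_prod_powi[OF assms, where a = "\<lambda>i. - \<alpha> i" and r = r and A = UNIV] by (simp add: sum_negf)
  then show ?thesis
    unfolding mono_int_def[of "\<lambda>i. d i / mono_int x (r i)"] mono_int_def[of d]
    by (simp add: power_int_mult_distrib power_int_inverse power_int_minus divide_inverse prod.distrib)
qed

text \<open>Since distinct real powers of \<open>t\<close> are linearly independent, an expression
  of \<open>1\<close> by terms of positive weight may be restricted to the terms free of
  \<open>t\<close>. There positive weight means a positive pairing with \<open>u\<close>, which
  \<open>trop_no_positive_relation\<close> excludes.\<close>

lemma one_not_in_weight_gt_span: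
  fixes r :: "'i::finite \<Rightarrow> 'n::finite \<Rightarrow> int"
  assumes u: "u \<in> trop (dual_cone r k)"
    and e: "e \<in> osc_kernel r k" "\<And>i. e i \<noteq> 0"
    and \<rho>: "\<And>d x t. d \<in> osc_kernel r k \<Longrightarrow> \<forall>i. d i \<noteq> 0 \<Longrightarrow> \<forall>j. x j \<noteq> 0 \<Longrightarrow> 0 < t \<Longrightarrow> \<exists>p. \<rho> p = (d, x, t)"
  shows "1 \<notin> add_span (weight_gt_gens \<rho> r u)"
proof
  assume "1 \<in> add_span (weight_gt_gens \<rho> r u)"
  from weight_gt_span_expansion[OF this] obtain n :: nat and z \<alpha> \<gamma> where
    pos: "\<And>s. s < n \<Longrightarrow> 0 < \<gamma> s + (\<Sum>i\<in>UNIV. real_of_int (\<alpha> s i) * u i)"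
    and one: "1 = (\<lambda>p. \<Sum>s<n. cone_monomial \<rho> r (z s) (\<alpha> s) (\<gamma> s) p)" by blast
  let ?A = "{s. s < n \<and> \<gamma> s = 0}"
  show False
  proof (rule trop_no_positive_relation[OF u e])
    show "finite ?A" by simp
    show "0 < (\<Sum>i\<in>UNIV. real_of_int (\<alpha> s i) * u i)" if "s \<in> ?A" for s
      using pos[of s] that by simp
    fix d and x :: "'n \<Rightarrow> complex"
    assume d: "d \<in> osc_kernel r k" "\<forall>i. d i \<noteq> 0" and x: "\<forall>j. x j \<noteq> 0"
    define b where "b s = z s * mono_int (\<lambda>i. d i / mono_int x (r i)) (\<alpha> s)" for s
    \<comment> \<open>\<open>B \<delta>\<close> is the coefficient of \<open>t powr \<delta>\<close>
      in the expression minus \<open>1\<close>. The exponent 0 is inserted so that the constant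
      \<open>1\<close> is counted even if no term has that exponent.\<close>
    define \<Gamma> where "\<Gamma> = insert 0 (\<gamma> ` {..<n})"
    define B where "B \<delta> = (\<Sum>s | s \<in> {..<n} \<and> \<gamma> s = \<delta>. b s) - (if \<delta> = 0 then 1 else 0)" for \<delta>
    have "B 0 = 0"
    proof (rule powr_linear_independent)
      show "finite \<Gamma>" "0 \<in> \<Gamma>" by (simp_all add: \<Gamma>_def)
      fix t :: real assume t: "0 < t"
      obtain p where p: "\<rho> p = (d, x, t)" using \<rho>[OF d x t] by blast
      have "(\<Sum>s<n. b s * of_real (t powr \<gamma> s)) = 1"
        using fun_cong[OF one, of p] x
        by (simp add: cone_monomial_def mixed_monomial_def p b_def mono_int_divide mult.assoc)
      moreover have "(\<Sum>s<n. b s * of_real (t powr \<gamma> s))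
        = (\<Sum>\<delta>\<in>\<Gamma>. \<Sum>s | s \<in> {..<n} \<and> \<gamma> s = \<delta>. b s * of_real (t powr \<gamma> s))"
        by (rule sum.group[symmetric]) (auto simp: \<Gamma>_def)
      moreover have "\<dots> = (\<Sum>\<delta>\<in>\<Gamma>. (\<Sum>s | s \<in> {..<n} \<and> \<gamma> s = \<delta>. b s) * of_real (t powr \<delta>))"
        unfolding sum_distrib_right by (intro sum.cong refl) auto
      moreover have "(\<Sum>\<delta>\<in>\<Gamma>. (if \<delta> = 0 then 1 else 0) * complex_of_real (t powr \<delta>))
        = (\<Sum>\<delta>\<in>\<Gamma>. if \<delta> = 0 then 1 else 0)"
        using t by (intro sum.cong) auto
      moreover have "(\<Sum>\<delta>\<in>\<Gamma>. if \<delta> = 0 then 1 else 0) = (1 :: complex)"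
        by (simp add: \<Gamma>_def)
      ultimately show "(\<Sum>\<delta>\<in>\<Gamma>. B \<delta> * of_real (t powr \<delta>)) = 0"
        by (simp add: B_def left_diff_distrib sum_subtractf)
    qed
    then show "(\<Sum>s\<in>?A. z s * mono_int (\<lambda>i. d i / mono_int x (r i)) (\<alpha> s)) = 1"
      by (simp add: B_def b_def)
  qed
qed

text \<open>Weights add under multiplication, so nonnegative weights give a ring and positive ones
  an ideal in it; properness is the hypothesis \<open>one\<close>.\<close>

lemma weight_span_pair:
  fixes r :: "'i::finite \<Rightarrow> 'n::finite \<Rightarrow> int"
  assumes \<rho>: "torus_valued \<rho>" and one: "1 \<notin> add_span (weight_gt_gens \<rho> r u)"
  shows "ring_ideal_pair (add_span (weight_ge_gens \<rho> r u)) (add_span (weight_gt_gens \<rho> r u))"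
    (is "ring_ideal_pair ?B ?m")
proof (rule ring_ideal_pairI)
  have "cone_monomial \<rho> r 1 (\<lambda>_. 0) 0 \<in> weight_ge_gens \<rho> r u"
    by (intro weight_gensI) simp
  then have "(\<lambda>_. 1) \<in> weight_ge_gens \<rho> r u" by (simp only: cone_monomial_const[OF \<rho>])
  from add_span_base[OF this] show "1 \<in> ?B" by (simp add: one_fun_def)
  show "f - g \<in> ?B \<and> f * g \<in> ?B" if "f \<in> ?B" "g \<in> ?B" for f g
  proof
    show "f - g \<in> ?B"
    proof (rule add_span_diff[OF _ that])
      fix g assume "g \<in> weight_ge_gens \<rho> r u"
      then show "- g \<in> weight_ge_gens \<rho> r u"
        unfolding weight_ge_gens_def using cone_monomial_uminus by fastforce
    qed
    show "f * g \<in> ?B" by (rule add_span_mult[OF weight_gens_mult(1)[OF \<rho>] that])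
  qed
  show "?m \<subseteq> ?B"
    by (rule add_span_mono) (force simp: weight_ge_gens_def weight_gt_gens_def intro: less_imp_le)
  show "f * g \<in> ?m" if "f \<in> ?B" "g \<in> ?m" for f g
    by (rule add_span_mult[OF weight_gens_mult(2)[OF \<rho>] that])
qed (use one in \<open>auto intro: add_span.zero add_span_add\<close>)

text \<open>The vector \<open>w\<close> is chosen so that \<open>v i < v l\<close> forces the
  quotient of \<open>d l\<close> by \<open>d i\<close> into the ideal of the valuation pair. A
  linear relation among the \<open>d l\<close> with a unique minimum would then put \<open>1\<close>
  into that ideal.\<close>

lemma tropical_point_if_trop:
  fixes r :: "'i::finite \<Rightarrow> 'n::finite \<Rightarrow> int"
  assumes u: "u \<in> trop (dual_cone r k)"
  shows "\<exists>w. \<forall>Q. mpoly_fin Q \<and> deg_le Q k \<longrightarrow> w \<in> euler_V r u Q"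
proof -
  have "\<exists>e\<in>osc_kernel r k. \<forall>i\<in>UNIV. e i \<noteq> 0"
    using osc_kernel_zero
    by (intro generic_vector_exists osc_kernel_lin osc_kernel_coordinate_nonzero[OF u]) auto
  then obtain e where e: "e \<in> osc_kernel r k" "\<And>i. e i \<noteq> 0" by blast
  define P :: "(('i \<Rightarrow> complex) \<times> ('n \<Rightarrow> complex) \<times> real) set" where
    "P = {(d, x, t). d \<in> osc_kernel r k \<and> (\<forall>i. d i \<noteq> 0) \<and> (\<forall>j. x j \<noteq> 0) \<and> 0 < t}"
  \<comment> \<open>Tuples outside \<open>P\<close> are sent to a fixed point of \<open>P\<close>,
    so that every value of \<rho> lies in the torus and in the kernel.\<close>
  define \<rho> :: "('i \<Rightarrow> complex) \<times> ('n \<Rightarrow> complex) \<times> real \<Rightarrow> _" where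
    "\<rho> p = (if p \<in> P then p else (e, \<lambda>_. 1, 1))" for p
  have \<rho>P: "\<rho> p \<in> P" for p using e by (simp add: \<rho>_def P_def)
  have tv: "torus_valued \<rho>" and ker: "\<And>p. fst (\<rho> p) \<in> osc_kernel r k"
    using \<rho>P by (simp_all add: torus_valued_def P_def case_prod_beta)
  note mult = mixed_monomial_mult[OF tv] and one = mixed_monomial_one[OF tv]
  have "\<exists>p. \<rho> p = (d, x, t)"
    if "d \<in> osc_kernel r k" "\<forall>i. d i \<noteq> 0" "\<forall>j. x j \<noteq> 0" "0 < t" for d x t
    using that by (intro exI[of _ "(d, x, t)"]) (simp add: \<rho>_def P_def)
  then have "1 \<notin> add_span (weight_gt_gens \<rho> r u)"
    by (rule one_not_in_weight_gt_span[OF u e])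
  from weight_span_pair[OF tv this] obtain V \<mm> where
    pair: "ring_ideal_pair V \<mm>" and BV: "add_span (weight_ge_gens \<rho> r u) \<subseteq> V"
    and m\<mm>: "add_span (weight_gt_gens \<rho> r u) \<subseteq> \<mm>"
    and val: "\<And>x y. x * y = 1 \<Longrightarrow> x \<notin> V \<Longrightarrow> y \<in> \<mm>"
    by (rule valuation_pair_exists) blast
  note R = ring_ideal_pairD[OF pair]
  define N where "N = {(b, \<gamma>). mixed_monomial \<rho> (\<lambda>_. 0) b \<gamma> \<in> V}"
  \<comment> \<open>The constraint of the pair \<open>(i, l)\<close> reads
    \<open>v l \<le> v i\<close>. It is imposed exactly when the corresponding monomial in
    \<open>x\<close> and \<open>t\<close> lies in \<open>V\<close>, and there are finitely many
    pairs.\<close>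
  define E where "E = ((\<lambda>(i, l). (\<lambda>j. r i j - r l j, u i - u l)) ` UNIV) \<inter> N"
  have "\<exists>w. \<forall>e\<in>E. 0 \<le> snd e + (\<Sum>j\<in>UNIV. w j * of_int (fst e j))"
  proof (rule fourier_motzkin[where N = N and J = UNIV])
    show "(\<lambda>j. a j + a' j, b + b') \<in> N" if "(a, b) \<in> N" "(a', b') \<in> N" for a b a' b'
    proof -
      have "mixed_monomial \<rho> (\<lambda>_. 0) a b * mixed_monomial \<rho> (\<lambda>_. 0) a' b' \<in> V"
        using that R(6) by (simp add: N_def)
      then show ?thesis by (simp add: N_def mult)
    qed
    \<comment> \<open>For negative \<open>b\<close> the monomial \<open>t powr (- b)\<close> has
      positive weight and lies in the ideal, so \<open>t powr b\<close> in \<open>V\<close> would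
      make \<open>1\<close> a member of it.\<close>
    show "0 \<le> b" if "(\<lambda>_. 0, b) \<in> N" for b
    proof (rule ccontr)
      assume "\<not> 0 \<le> b"
      then have "cone_monomial \<rho> r 1 (\<lambda>_. 0) (- b) \<in> weight_gt_gens \<rho> r u"
        by (intro weight_gensI) simp
      moreover have "cone_monomial \<rho> r 1 (\<lambda>_. 0) (- b) = mixed_monomial \<rho> (\<lambda>_. 0) (\<lambda>_. 0) (- b)"
        by (simp add: cone_monomial_def)
      ultimately have "mixed_monomial \<rho> (\<lambda>_. 0) (\<lambda>_. 0) (- b) \<in> \<mm>"
        using m\<mm> add_span_base by fastforce
      then have "mixed_monomial \<rho> (\<lambda>_. 0) (\<lambda>_. 0) b * mixed_monomial \<rho> (\<lambda>_. 0) (\<lambda>_. 0) (- b) \<in> \<mm>"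
        using that R(10) by (auto simp: N_def)
      then show False using R(14) by (simp add: mult one)
    qed
  qed (simp_all add: E_def)
  then obtain w where w: "\<And>e. e \<in> E \<Longrightarrow> 0 \<le> snd e + (\<Sum>j\<in>UNIV. w j * of_int (fst e j))" by blast
  define v where "v l = trop_term r u l w" for l
  \<comment> \<open>As \<open>w\<close> violates the constraint of \<open>(i, l)\<close>, its
    monomial is outside \<open>V\<close> and the inverse lies in the ideal. Multiplying that inverse
    by the quotient of \<open>c l\<close> by \<open>c i\<close> times
    \<open>t powr (u i - u l)\<close>, which has weight 0 and so lies in \<open>V\<close>, leaves
    the quotient of \<open>d l\<close> by \<open>d i\<close>.\<close>
  have ratio: "mixed_monomial \<rho> (\<lambda>s. (if s = l then 1 else 0) - (if s = i then 1 else 0)) (\<lambda>_. 0) 0 \<in> \<mm>"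
    (is "mixed_monomial \<rho> ?\<delta> _ _ \<in> _") if less: "v i < v l" for i l
  proof -
    let ?e = "(\<lambda>j. r i j - r l j, u i - u l)"
    have "snd ?e + (\<Sum>j\<in>UNIV. w j * of_int (fst ?e j)) = v i - v l"
      by (simp add: v_def trop_term_def right_diff_distrib sum_subtractf)
    moreover have "?e \<in> E" if "?e \<in> N"
      using that unfolding E_def by (intro IntI range_eqI[of _ _ "(i, l)"]) simp_all
    ultimately have "?e \<notin> N" using w[of ?e] less by auto
    then have nV: "mixed_monomial \<rho> (\<lambda>_. 0) (\<lambda>j. r i j - r l j) (u i - u l) \<notin> V" by (simp add: N_def)
    have "mixed_monomial \<rho> (\<lambda>_. 0) (\<lambda>j. r i j - r l j) (u i - u l) *
      mixed_monomial \<rho> (\<lambda>_. 0) (\<lambda>j. r l j - r i j) (u l - u i) = 1"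
      by (simp add: mult one)
    from val[OF this nV] have y: "mixed_monomial \<rho> (\<lambda>_. 0) (\<lambda>j. r l j - r i j) (u l - u i) \<in> \<mm>" .
    have coord: "(\<Sum>s\<in>UNIV. real_of_int (?\<delta> s) * u s) = u l - u i"
      by (simp add: left_diff_distrib sum_subtractf if_distrib[of "\<lambda>x. x * _"] if_distrib[of real_of_int] cong: if_cong)
    have "0 \<le> (u i - u l) + (\<Sum>s\<in>UNIV. real_of_int (?\<delta> s) * u s)" using coord by linarith
    then have "cone_monomial \<rho> r 1 ?\<delta> (u i - u l) \<in> weight_ge_gens \<rho> r u" by (rule weight_gensI)
    then have x: "cone_monomial \<rho> r 1 ?\<delta> (u i - u l) \<in> V" using BV add_span_base by blast
    have exps: "(\<Sum>s\<in>UNIV. ?\<delta> s * r s j) = r l j - r i j" for j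
      by (simp add: left_diff_distrib sum_subtractf if_distrib[of "\<lambda>x. x * _"] cong: if_cong)
    have "cone_monomial \<rho> r 1 ?\<delta> (u i - u l) = mixed_monomial \<rho> ?\<delta> (\<lambda>j. - (r l j - r i j)) (u i - u l)"
      unfolding cone_monomial_def exps by simp
    then have "cone_monomial \<rho> r 1 ?\<delta> (u i - u l) * mixed_monomial \<rho> (\<lambda>_. 0) (\<lambda>j. r l j - r i j) (u l - u i)
      = mixed_monomial \<rho> ?\<delta> (\<lambda>_. 0) 0"
      by (simp add: mult)
    with R(10)[OF x y] show ?thesis by simp
  qed
  have const: "(\<lambda>_. z) \<in> V" for z
  proof -
    have "cone_monomial \<rho> r z (\<lambda>_. 0) 0 \<in> weight_ge_gens \<rho> r u"
      by (intro weight_gensI) simp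
    then show ?thesis using BV add_span_base cone_monomial_const[OF tv] by fastforce
  qed
  have "w \<in> euler_V r u Q" if Q: "mpoly_fin Q" "deg_le Q k" for Q
  proof (rule ccontr)
    assume no: "w \<notin> euler_V r u Q"
    define f where "f i = mpoly_eval Q (\<lambda>j. of_int (r i j))" for i
    have f: "f \<in> poly_values r k" using Q unfolding f_def poly_values_def by blast
    let ?S = "{i. f i \<noteq> 0}"
    have no: "?S \<noteq> {}" "\<And>i l. i \<in> ?S \<Longrightarrow> l \<in> ?S \<Longrightarrow> i \<noteq> l \<Longrightarrow> v i = v l \<Longrightarrow> \<exists>s\<in>?S. v s < v i"
      using no unfolding euler_V_def trop_V_def f_def v_def by (auto simp: not_le)
    \<comment> \<open>If \<open>w\<close> lies outside \<open>euler_V r u Q\<close>, the minimum of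
      \<open>v\<close> on the support is attained at \<open>i\<close> alone.\<close>
    obtain i where i: "i \<in> ?S" "\<And>l. l \<in> ?S \<Longrightarrow> v i \<le> v l"
      using no(1) ex_min_if_finite[of "v ` ?S"] by (auto simp: not_less)
    have less: "v i < v l" if "l \<in> ?S" "l \<noteq> i" for l
    proof (rule ccontr)
      assume "\<not> v i < v l"
      with i(2)[OF that(1)] have "v i = v l" by simp
      with no(2)[OF i(1) that(1)] that(2) i(2) show False by fastforce
    qed
    let ?q = "\<lambda>l. mixed_monomial \<rho> (\<lambda>s. (if s = l then 1 else 0) - (if s = i then 1 else 0)) (\<lambda>_. 0) 0"
    have q: "?q l p = fst (\<rho> p) l / fst (\<rho> p) i" for l p
    proof -
      have ne: "fst (\<rho> p) s \<noteq> 0" for s using tv unfolding torus_valued_def by blast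
      have "mono_int x (\<lambda>s. if s = l then 1 else 0) = x l" for x :: "'i \<Rightarrow> complex" and l
        by (simp add: mono_int_def if_distrib[of "\<lambda>n. _ powi n"] cong: if_cong)
      moreover have "mono_int (fst (\<rho> p)) (\<lambda>s. (if s = l then 1 else 0) - (if s = i then 1 else 0)) *
          mono_int (fst (\<rho> p)) (\<lambda>s. if s = i then 1 else 0) = mono_int (fst (\<rho> p)) (\<lambda>s. if s = l then 1 else 0)"
        using ne by (simp flip: mono_int_add)
      moreover have "snd (snd (\<rho> p)) > 0" using tv unfolding torus_valued_def by blast
      ultimately show ?thesis using ne[of i]
        by (simp add: mixed_monomial_def mono_int_def[of _ "\<lambda>_. 0"] field_simps)
    qed
    \<comment> \<open>Solving the relation given by \<open>f\<close> for coordinate \<open>i\<close>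
      and dividing by that coordinate expresses \<open>1\<close> through the quotients in the
      ideal.\<close>
    have "(\<Sum>l\<in>?S - {i}. (\<lambda>_. - of_rat (f l) / of_rat (f i)) * ?q l) \<in> \<mm>"
      using less by (intro ring_ideal_pair_sum(2)[OF pair] R(10) const ratio) auto
    moreover have "(\<Sum>l\<in>?S - {i}. (\<lambda>_. - of_rat (f l) / of_rat (f i)) * ?q l) = 1"
    proof
      fix p
      have ne: "fst (\<rho> p) i \<noteq> 0" using tv unfolding torus_valued_def by blast
      have "0 = (\<Sum>l\<in>UNIV. of_rat (f l) * fst (\<rho> p) l)"
        using ker[of p] f by (auto simp: osc_kernel_def)
      also have "\<dots> = (\<Sum>l\<in>?S. of_rat (f l) * fst (\<rho> p) l)"
        by (rule sum.mono_neutral_right) auto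
      also have "\<dots> = of_rat (f i) * fst (\<rho> p) i + (\<Sum>l\<in>?S - {i}. of_rat (f l) * fst (\<rho> p) l)"
        using i(1) by (intro sum.remove) auto
      finally have rest: "(\<Sum>l\<in>?S - {i}. of_rat (f l) * fst (\<rho> p) l) = - of_rat (f i) * fst (\<rho> p) i"
        by (simp add: eq_neg_iff_add_eq_0 add.commute)
      have total: "(\<Sum>l\<in>A. (\<lambda>_. - of_rat (f l) / of_rat (f i)) * ?q l) p
        = - (\<Sum>l\<in>A. of_rat (f l) * fst (\<rho> p) l) / (of_rat (f i) * fst (\<rho> p) i)" for A
        by (induction A rule: infinite_finite_induct) (auto simp: q add_divide_distrib diff_divide_distrib)
      show "(\<Sum>l\<in>?S - {i}. (\<lambda>_. - of_rat (f l) / of_rat (f i)) * ?q l) p = 1 p"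
        unfolding total rest using ne i(1) by simp
    qed
    ultimately show False using R(14) by simp
  qed
  then show ?thesis by blast
qed

theorem theorem5p5:
  fixes r :: "'i::finite \<Rightarrow> 'n::finite \<Rightarrow> int" and k :: nat and u :: "'i \<Rightarrow> real"
  assumes "inj r"
    and "\<forall>z :: 'n \<Rightarrow> int. \<exists>a :: 'i \<Rightarrow> int. z = (\<lambda>j. \<Sum>i\<in>UNIV. a i * r i j)"
  shows "(u \<in> trop (dual_cone r k) \<longleftrightarrow>
           (\<Inter>Q\<in>{Q :: ('n \<Rightarrow> nat) \<Rightarrow> rat. mpoly_fin Q \<and> deg_le Q k}. euler_V r u Q) \<noteq> {})
         \<and> (\<exists>\<F>. finite \<F> \<and> \<F> \<subseteq> {Q :: ('n \<Rightarrow> nat) \<Rightarrow> rat. mpoly_fin Q \<and> deg_le Q k} \<and>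
              (\<Inter>Q\<in>\<F>. euler_V r u Q) =
              (\<Inter>Q\<in>{Q :: ('n \<Rightarrow> nat) \<Rightarrow> rat. mpoly_fin Q \<and> deg_le Q k}. euler_V r u Q))"
proof
  show "u \<in> trop (dual_cone r k) \<longleftrightarrow>
      (\<Inter>Q\<in>{Q :: ('n \<Rightarrow> nat) \<Rightarrow> rat. mpoly_fin Q \<and> deg_le Q k}. euler_V r u Q) \<noteq> {}"
  proof
    assume "u \<in> trop (dual_cone r k)"
    then show "(\<Inter>Q\<in>{Q :: ('n \<Rightarrow> nat) \<Rightarrow> rat. mpoly_fin Q \<and> deg_le Q k}. euler_V r u Q) \<noteq> {}"
      using tropical_point_if_trop by fastforce
  next
    assume "(\<Inter>Q\<in>{Q :: ('n \<Rightarrow> nat) \<Rightarrow> rat. mpoly_fin Q \<and> deg_le Q k}. euler_V r u Q) \<noteq> {}"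
    then obtain w where "\<And>Q. mpoly_fin Q \<Longrightarrow> deg_le Q k \<Longrightarrow> w \<in> euler_V r u Q" by auto
    then show "u \<in> trop (dual_cone r k)" by (rule trop_if_tropical_point)
  qed
  let ?\<Q> = "{Q :: ('n \<Rightarrow> nat) \<Rightarrow> rat. mpoly_fin Q \<and> deg_le Q k}"
    and ?supp = "\<lambda>Q :: ('n \<Rightarrow> nat) \<Rightarrow> rat. {i. mpoly_eval Q (\<lambda>j. of_int (r i j)) \<noteq> 0}"
  \<comment> \<open>\<open>euler_V r u Q\<close> depends on \<open>Q\<close> only through the
    support of its value vector. The index type is finite, so there are finitely many supports and
    one \<open>Q\<close> for each suffices.\<close>
  obtain \<F> where \<F>: "\<F> \<subseteq> ?\<Q>" "finite \<F>" "?supp ` ?\<Q> = ?supp ` \<F>"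
    using finite_subset_image[of "?supp ` ?\<Q>" ?supp ?\<Q>] by auto
  have "(\<Inter>Q\<in>\<G>. euler_V r u Q) = (\<Inter>S\<in>?supp ` \<G>. trop_V S (trop_term r u))" for \<G>
    by (simp add: euler_V_def)
  then have "(\<Inter>Q\<in>\<F>. euler_V r u Q) = (\<Inter>Q\<in>?\<Q>. euler_V r u Q)"
    by (simp only: \<F>(3))
  with \<F>(1,2) show "\<exists>\<F>. finite \<F> \<and> \<F> \<subseteq> ?\<Q> \<and> (\<Inter>Q\<in>\<F>. euler_V r u Q) = (\<Inter>Q\<in>?\<Q>. euler_V r u Q)"
    by blast
qed

end
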